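(* Let $\Theta=(\Sigma,\varphi)$ be a connected $\mathbb{T}$-gain graph on vertices $v_1,\dots,v_n$ with a vertex ordering $<$. Then $$\det(DL^{\max}_{<}(\Theta))=\sum_{\Upsilon}\ \prod_{\{v_j,v_k\}\in E(\Upsilon)}d(v_j,v_k)\prod_{C}2\big(1-\mathrm{Re}(\varphi^{\max}_{<}(\overrightarrow{C}))\big),$$ where the sum is over all spanning 1-forests $\Upsilon$ of the complete graph $K_n$ on $\{v_1,\dots,v_n\}$, the inner product is over the cycles $C$ of $\Upsilon$, and for a cycle $u_1u_2\cdots u_ru_1$, $\varphi^{\max}_{<}(\overrightarrow{C})=\varphi^{\max}_{<}(u_1,u_2)\varphi^{\max}_{<}(u_2,u_3)\cdots\varphi^{\max}_{<}(u_r,u_1)$. The analogous formulas hold for $\det(DL^{\min}_{<}(\Theta))$ with $\varphi^{\min}_{<}$, and, when $D^{\max}_{<}(\Theta)=D^{\min}_{<}(\Theta)$, for $\det(DL(\Theta))$ with the common auxiliary gain.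
   Context: $\mathbb{T}=\{z\in\mathbb{C}:|z|=1\}$. A $\mathbb{T}$-gain graph $\Theta=(\Sigma,\varphi)$: simple finite graph $\Sigma$, $\varphi$ from oriented edges to $\mathbb{T}$ with $\varphi(\vec e_{k,j})=\varphi(\vec e_{j,k})^{-1}$; gain of an oriented path = product of gains of its edges in order. $d$ is graph distance. For $y<z$, $\varphi^{\max}_{<}(y,z)$ (resp. $\varphi^{\min}_{<}(y,z)$) is the maximum (resp. minimum), in the lexicographic order on $\mathbb{C}$ (real part first, then imaginary part), of the gains of the shortest paths from $y$ to $z$; $\varphi^{\max}_{<}(z,y)=\overline{\varphi^{\max}_{<}(y,z)}$, likewise for min. $D^{\max}_{<}(\Theta)$ has $(s,t)$ entry $\varphi^{\max}_{<}(v_s,v_t)d(v_s,v_t)$ for $s\ne t$, $0$ on the diagonal; $D^{\min}_{<}$ similarly. $Tr(\Sigma)=\mathrm{diag}(tr(v_j))$ with $tr(v)=\sum_u d(v,u)$. $DL^{\max}_{<}=Tr(\Sigma)-D^{\max}_{<}$, $DL^{\min}_{<}=Tr(\Sigma)-D^{\min}_{<}$, and $DL(\Theta)$ is their common value when $D^{\max}_{<}=D^{\min}_{<}$. A 1-tree is a connected graph with exactly one cycle; a spanning 1-forest is a spanning subgraph all of whose components are 1-trees. *)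

theory Defs
  imports "HOL-Analysis.Analysis"
begin

section \<open>Simple graphs: paths, distance, components, cycles\<close>

text \<open>A graph is given by a vertex set \<open>V\<close> and a set \<open>E\<close> of two-element subsets of \<open>V\<close>.\<close>

definition simple_graph :: "'v set \<Rightarrow> 'v set set \<Rightarrow> bool" where
  "simple_graph V E \<longleftrightarrow> finite V \<and> (\<forall>e\<in>E. e \<subseteq> V \<and> card e = 2)"

definition complete_edges :: "'v set \<Rightarrow> 'v set set" where
  "complete_edges V = {e. e \<subseteq> V \<and> card e = 2}"

definition path_between :: "'v set \<Rightarrow> 'v set set \<Rightarrow> 'v \<Rightarrow> 'v \<Rightarrow> 'v list \<Rightarrow> bool" where
  "path_between V E u v p \<longleftrightarrow>
     p \<noteq> [] \<and> hd p = u \<and> last p = v \<and> set p \<subseteq> V \<and> distinct p \<and>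
     successively (\<lambda>x y. {x, y} \<in> E) p"

definition connected_graph :: "'v set \<Rightarrow> 'v set set \<Rightarrow> bool" where
  "connected_graph V E \<longleftrightarrow> (\<forall>u\<in>V. \<forall>v\<in>V. \<exists>p. path_between V E u v p)"

text \<open>The number of edges of a path is one less than the length of its vertex list.\<close>

definition graph_dist :: "'v set \<Rightarrow> 'v set set \<Rightarrow> 'v \<Rightarrow> 'v \<Rightarrow> nat" where
  "graph_dist V E u v = (LEAST k. \<exists>p. path_between V E u v p \<and> length p - 1 = k)"

definition shortest_path :: "'v set \<Rightarrow> 'v set set \<Rightarrow> 'v \<Rightarrow> 'v \<Rightarrow> 'v list \<Rightarrow> bool" where
  "shortest_path V E u v p \<longleftrightarrow>
     path_between V E u v p \<and> length p - 1 = graph_dist V E u v"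

text \<open>The distance between the two ends of an unordered pair \<open>{u, v}\<close>;
  see \<open>pair_dist_insert\<close> below for well-definedness.\<close>

definition pair_dist :: "'v set \<Rightarrow> 'v set set \<Rightarrow> 'v set \<Rightarrow> nat" where
  "pair_dist V E e = (THE k. \<exists>u v. e = {u, v} \<and> k = graph_dist V E u v)"

definition graph_components :: "'v set \<Rightarrow> 'v set set \<Rightarrow> 'v set set" where
  "graph_components V E = {{u. \<exists>p. path_between V E v u p} | v. v \<in> V}"

text \<open>An oriented cycle \<open>u\<^sub>1 u\<^sub>2 \<dots> u\<^sub>r u\<^sub>1\<close> is written as the list \<open>[u\<^sub>1, \<dots>, u\<^sub>r]\<close>.
  The (unoriented) cycles of a graph are identified with their edge sets.\<close>

definition cycle_edges :: "'v list \<Rightarrow> 'v set set" where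
  "cycle_edges c = {{c ! i, c ! (Suc i mod length c)} | i. i < length c}"

definition traverses_cycle :: "'v list \<Rightarrow> 'v set set \<Rightarrow> bool" where
  "traverses_cycle c C \<longleftrightarrow> 3 \<le> length c \<and> distinct c \<and> cycle_edges c = C"

definition graph_cycles :: "'v set set \<Rightarrow> 'v set set set" where
  "graph_cycles E = {C. C \<subseteq> E \<and> (\<exists>c. traverses_cycle c C)}"

definition one_tree :: "'v set \<Rightarrow> 'v set set \<Rightarrow> bool" where
  "one_tree V E \<longleftrightarrow>
     simple_graph V E \<and> connected_graph V E \<and> (\<exists>!C. C \<in> graph_cycles E)"

text \<open>A spanning subgraph of the complete graph on \<open>V\<close> is identified with its edge set.\<close>

definition spanning_one_forests :: "'v set \<Rightarrow> 'v set set set" where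
  "spanning_one_forests V =
     {F. F \<subseteq> complete_edges V \<and>
         (\<forall>W\<in>graph_components V F. one_tree W {e \<in> F. e \<subseteq> W})}"


section \<open>Gain graphs over the unit circle\<close>

text \<open>\<open>\<phi> u v\<close> is the gain of the edge \<open>{u, v}\<close> oriented from \<open>u\<close> to \<open>v\<close>;
  its values off the edges are irrelevant.\<close>

definition gain_graph ::
    "'v set \<Rightarrow> 'v set set \<Rightarrow> ('v \<Rightarrow> 'v \<Rightarrow> complex) \<Rightarrow> bool" where
  "gain_graph V E \<phi> \<longleftrightarrow>
     simple_graph V E \<and>
     (\<forall>u v. {u, v} \<in> E \<longrightarrow> cmod (\<phi> u v) = 1 \<and> \<phi> v u = inverse (\<phi> u v))"

definition path_gain :: "('v \<Rightarrow> 'v \<Rightarrow> complex) \<Rightarrow> 'v list \<Rightarrow> complex" where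
  "path_gain \<phi> p = (\<Prod>i<length p - 1. \<phi> (p ! i) (p ! Suc i))"

definition cycle_gain :: "('v \<Rightarrow> 'v \<Rightarrow> complex) \<Rightarrow> 'v list \<Rightarrow> complex" where
  "cycle_gain g c = (\<Prod>i<length c. g (c ! i) (c ! (Suc i mod length c)))"

definition lex_le :: "complex \<Rightarrow> complex \<Rightarrow> bool" where
  "lex_le z w \<longleftrightarrow> Re z < Re w \<or> (Re z = Re w \<and> Im z \<le> Im w)"

definition lex_Max :: "complex set \<Rightarrow> complex" where
  "lex_Max S = (THE z. z \<in> S \<and> (\<forall>w\<in>S. lex_le w z))"

definition lex_Min :: "complex set \<Rightarrow> complex" where
  "lex_Min S = (THE z. z \<in> S \<and> (\<forall>w\<in>S. lex_le z w))"

definition shortest_gains ::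
    "'v set \<Rightarrow> 'v set set \<Rightarrow> ('v \<Rightarrow> 'v \<Rightarrow> complex) \<Rightarrow> 'v \<Rightarrow> 'v \<Rightarrow> complex set" where
  "shortest_gains V E \<phi> y z = {path_gain \<phi> p | p. shortest_path V E y z p}"

text \<open>The vertex ordering is a strict linear order \<open>r\<close>, with \<open>(y, z) \<in> r\<close> meaning \<open>y < z\<close>.
  On the diagonal the auxiliary gains below take the value \<open>1\<close>, the gain of the trivial path.\<close>

definition gain_max ::
    "('v \<times> 'v) set \<Rightarrow> 'v set \<Rightarrow> 'v set set \<Rightarrow> ('v \<Rightarrow> 'v \<Rightarrow> complex) \<Rightarrow> 'v \<Rightarrow> 'v \<Rightarrow> complex" where
  "gain_max r V E \<phi> y z =
     (if (y, z) \<in> r then lex_Max (shortest_gains V E \<phi> y z)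
      else cnj (lex_Max (shortest_gains V E \<phi> z y)))"

definition gain_min ::
    "('v \<times> 'v) set \<Rightarrow> 'v set \<Rightarrow> 'v set set \<Rightarrow> ('v \<Rightarrow> 'v \<Rightarrow> complex) \<Rightarrow> 'v \<Rightarrow> 'v \<Rightarrow> complex" where
  "gain_min r V E \<phi> y z =
     (if (y, z) \<in> r then lex_Min (shortest_gains V E \<phi> y z)
      else cnj (lex_Min (shortest_gains V E \<phi> z y)))"


section \<open>Gain distance matrices and gain distance Laplacians\<close>

text \<open>From here on the vertex set is a finite type, which also indexes rows and columns.\<close>

definition D_max ::
    "('n \<times> 'n) set \<Rightarrow> 'n::finite set set \<Rightarrow> ('n \<Rightarrow> 'n \<Rightarrow> complex) \<Rightarrow> complex^'n^'n" where
  "D_max r E \<phi> =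
     (\<chi> s t. if s = t then 0 else gain_max r UNIV E \<phi> s t * of_nat (graph_dist UNIV E s t))"

definition D_min ::
    "('n \<times> 'n) set \<Rightarrow> 'n::finite set set \<Rightarrow> ('n \<Rightarrow> 'n \<Rightarrow> complex) \<Rightarrow> complex^'n^'n" where
  "D_min r E \<phi> =
     (\<chi> s t. if s = t then 0 else gain_min r UNIV E \<phi> s t * of_nat (graph_dist UNIV E s t))"

definition Tr_matrix :: "'n::finite set set \<Rightarrow> complex^'n^'n" where
  "Tr_matrix E = (\<chi> s t. if s = t then of_nat (\<Sum>u\<in>UNIV. graph_dist UNIV E s u) else 0)"

definition DL_max ::
    "('n \<times> 'n) set \<Rightarrow> 'n::finite set set \<Rightarrow> ('n \<Rightarrow> 'n \<Rightarrow> complex) \<Rightarrow> complex^'n^'n" where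
  "DL_max r E \<phi> = Tr_matrix E - D_max r E \<phi>"

definition DL_min ::
    "('n \<times> 'n) set \<Rightarrow> 'n::finite set set \<Rightarrow> ('n \<Rightarrow> 'n \<Rightarrow> complex) \<Rightarrow> complex^'n^'n" where
  "DL_min r E \<phi> = Tr_matrix E - D_min r E \<phi>"

text \<open>Meaningful only if the two arguments coincide.\<close>

definition common_value :: "'a \<Rightarrow> 'a \<Rightarrow> 'a" where
  "common_value x y = (THE z. z = x \<and> z = y)"

definition DL_common ::
    "('n \<times> 'n) set \<Rightarrow> 'n::finite set set \<Rightarrow> ('n \<Rightarrow> 'n \<Rightarrow> complex) \<Rightarrow> complex^'n^'n" where
  "DL_common r E \<phi> = common_value (DL_max r E \<phi>) (DL_min r E \<phi>)"

definition gain_common ::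
    "('v \<times> 'v) set \<Rightarrow> 'v set \<Rightarrow> 'v set set \<Rightarrow> ('v \<Rightarrow> 'v \<Rightarrow> complex) \<Rightarrow> 'v \<Rightarrow> 'v \<Rightarrow> complex" where
  "gain_common r V E \<phi> = common_value (gain_max r V E \<phi>) (gain_min r V E \<phi>)"


section \<open>Well-definedness\<close>

lemma path_between_rev: "path_between V E u v p \<Longrightarrow> path_between V E v u (rev p)"
  by (auto simp: path_between_def hd_rev last_rev insert_commute)

lemma graph_dist_commute: "graph_dist V E u v = graph_dist V E v u"
proof -
  have "(\<exists>p. path_between V E u v p \<and> length p - 1 = k) \<longleftrightarrow>
        (\<exists>p. path_between V E v u p \<and> length p - 1 = k)" for k
    by (metis path_between_rev length_rev)
  then show ?thesis by (simp add: graph_dist_def)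
qed

lemma pair_dist_insert: "pair_dist V E {u, v} = graph_dist V E u v"
  unfolding pair_dist_def
  by (rule the_equality) (auto simp: doubleton_eq_iff graph_dist_commute)

lemma lex_Max_eq: "z \<in> S \<Longrightarrow> (\<And>w. w \<in> S \<Longrightarrow> lex_le w z) \<Longrightarrow> lex_Max S = z"
  unfolding lex_Max_def
  by (rule the_equality) (auto simp: lex_le_def complex_eq_iff, (force)+)

lemma lex_Min_eq: "z \<in> S \<Longrightarrow> (\<And>w. w \<in> S \<Longrightarrow> lex_le z w) \<Longrightarrow> lex_Min S = z"
  unfolding lex_Min_def
  by (rule the_equality) (auto simp: lex_le_def complex_eq_iff, (force)+)

lemma common_value_same: "x = y \<Longrightarrow> common_value x y = x"
  by (simp add: common_value_def)

end

theory Submission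
  imports Defs
begin

text \<open>
  Row \<open>s\<close> of the Laplacian is \<open>\<Sum>t. w {s, t} *s (axis s 1 - g s t *s axis t 1)\<close>, so by
  multilinearity its determinant is a sum over functions \<open>f\<close> on the vertices of
  \<open>\<Prod>s. w {s, f s}\<close> times the determinant of the matrix with rows
  \<open>axis s 1 - g s (f s) *s axis (f s) 1\<close>. The latter is the product of \<open>1 - g(C)\<close> over the
  directed cycles \<open>C\<close> of \<open>f\<close>; it vanishes if \<open>f\<close> has a cycle of length two. The edge sets
  \<open>{{s, f s} | s}\<close> of the remaining functions are exactly the spanning 1-forests. To sum over
  all \<open>f\<close> with the same edge set \<open>F\<close>, apply the expansion to the unit-weight Laplacian of
  \<open>F\<close>: it is \<open>B\<^sup>* B\<close> for the matrix \<open>B\<close> of any one such \<open>f\<close>, so the sum is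
  \<open>|det B|\<^sup>2\<close>, the product of \<open>|1 - g(C)|\<^sup>2 = 2 (1 - Re (g(C)))\<close> over the cycles of \<open>F\<close>.
\<close>

section \<open>Limit sets of self-maps\<close>

definition functional_edges :: "('a \<Rightarrow> 'a) \<Rightarrow> 'a set set" where
  "functional_edges f = range (\<lambda>s. {s, f s})"

text \<open>These are the functions that survive in the determinant expansion: a fixed point would
  need a weight on a loop, and a 2-cycle gives two proportional rows.\<close>

definition no_short_cycles :: "('a \<Rightarrow> 'a) \<Rightarrow> bool" where
  "no_short_cycles f \<longleftrightarrow> (\<forall>s. f s \<noteq> s \<and> f (f s) \<noteq> s)"

text \<open>On a finite type this is the directed cycle in which the orbit of \<open>v\<close> ends.
  Asking for infinitely many visits needs no choice of a starting point or a period.\<close>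

definition limit_set :: "('a \<Rightarrow> 'a) \<Rightarrow> 'a \<Rightarrow> 'a set" where
  "limit_set f v = {x. \<exists>\<^sub>\<infinity>k. (f ^^ k) v = x}"

lemma limit_set_step: "limit_set f (f v) = limit_set f v"
proof -
  have "(\<exists>\<^sub>\<infinity>k. (f ^^ k) (f v) = x) \<longleftrightarrow> (\<exists>\<^sub>\<infinity>k. (f ^^ k) v = x)" for x
    using MOST_Suc_iff[of "\<lambda>k. (f ^^ k) v \<noteq> x"]
    unfolding frequently_def by (simp only: funpow_Suc_right o_apply)
  then show ?thesis by (simp add: limit_set_def)
qed

lemma limit_set_funpow: "limit_set f ((f ^^ k) v) = limit_set f v"
  by (induction k) (simp_all add: limit_set_step)

lemma limit_set_nonempty:
  fixes v :: "'a::finite"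
  shows "limit_set f v \<noteq> {}"
proof -
  have "\<exists>x\<in>UNIV. infinite {k\<in>UNIV. (f ^^ k) v = x}"
    by (rule pigeonhole_infinite_rel) auto
  then show ?thesis
    by (auto simp: limit_set_def frequently_cofinite)
qed

lemma limit_set_reachable:
  assumes "x \<in> limit_set f v"
  obtains k where "(f ^^ k) v = x"
  using assms by (auto simp: limit_set_def dest!: INFM_EX)

lemma limit_set_of_member:
  assumes "x \<in> limit_set f v"
  shows "limit_set f x = limit_set f v"
  using assms by (metis limit_set_reachable limit_set_funpow)

lemma limit_set_closed:
  assumes "x \<in> limit_set f v"
  shows "f x \<in> limit_set f v"
proof -
  have "\<exists>\<^sub>\<infinity>k. (f ^^ k) v = x" using assms by (simp add: limit_set_def)
  then have "\<exists>\<^sub>\<infinity>k. (f ^^ Suc k) v = f x" by (rule frequently_elim1) simp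
  then have "\<exists>\<^sub>\<infinity>k. (f ^^ k) v = f x"
    unfolding frequently_def MOST_Suc_iff[of "\<lambda>k. (f ^^ k) v \<noteq> f x"] .
  then show ?thesis by (simp add: limit_set_def)
qed

text \<open>\<open>r\<close> is the least positive return time of \<open>x\<close>; one exists
  because \<open>x\<close>, lying in its own limit set, is visited infinitely often.\<close>

lemma limit_set_enumerate:
  assumes "x \<in> limit_set f v"
  obtains r where "0 < r" "(f ^^ r) x = x" "inj_on (\<lambda>i. (f ^^ i) x) {..<r}"
    "limit_set f v = (\<lambda>i. (f ^^ i) x) ` {..<r}"
proof -
  have X: "limit_set f v = limit_set f x" using assms by (simp add: limit_set_of_member)
  with assms have "x \<in> limit_set f x" by simp
  then have "\<exists>\<^sub>\<infinity>k. (f ^^ k) x = x" by (simp add: limit_set_def)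
  then have "\<exists>k>0. (f ^^ k) x = x" by (auto simp: INFM_nat)
  then obtain r where r: "0 < r" "(f ^^ r) x = x" "\<And>k. 0 < k \<Longrightarrow> k < r \<Longrightarrow> (f ^^ k) x \<noteq> x"
    using exists_least_iff[of "\<lambda>k. 0 < k \<and> (f ^^ k) x = x"] by blast
  have mod: "(f ^^ (i mod r)) x = (f ^^ i) x" for i
    using r(2) by (simp add: funpow_mod_eq)
  \<comment> \<open>A coincidence at times \<open>i < j < r\<close>, pushed on by
    \<open>r - j\<close> steps, would be a return at the positive time
    \<open>r - j + i < r\<close>.\<close>
  have ne: "(f ^^ i) x \<noteq> (f ^^ j) x" if "i < j" "j < r" for i j
  proof
    assume "(f ^^ i) x = (f ^^ j) x"
    then have "(f ^^ (r - j)) ((f ^^ i) x) = (f ^^ (r - j)) ((f ^^ j) x)" by simp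
    then have "(f ^^ (r - j + i)) x = (f ^^ (r - j + j)) x" by (simp add: funpow_add)
    moreover have "r - j + i < r" "0 < r - j + i" "r - j + j = r" using that by auto
    ultimately show False using r(2) r(3)[of "r - j + i"] by simp
  qed
  then have inj: "inj_on (\<lambda>i. (f ^^ i) x) {..<r}"
    by (auto simp: inj_on_def) (metis nat_neq_iff)
  have "(f ^^ i) x \<in> limit_set f x" for i
    using assms X by (induction i) (auto intro: limit_set_closed)
  moreover have "y \<in> (\<lambda>i. (f ^^ i) x) ` {..<r}" if "y \<in> limit_set f x" for y
    using limit_set_reachable[OF that] mod r(1) by (metis imageI lessThan_iff mod_less_divisor)
  ultimately show thesis using that[OF r(1,2) inj] X by blast
qed

section \<open>Expansion of the determinant\<close>

text \<open>An edge-vertex incidence matrix, square because vertex \<open>s\<close> labels the edge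
  from \<open>s\<close> to \<open>f s\<close>. The coefficients \<open>a\<close> are free so that a
  cycle can be cut by setting one of them to zero.\<close>

definition incidence :: "('n \<Rightarrow> complex) \<Rightarrow> ('n \<Rightarrow> 'n) \<Rightarrow> complex^'n^'n::finite" where
  "incidence a f = (\<chi> s. axis s 1 - a s *s axis (f s) 1)"

text \<open>In the Leibniz sum a contributing permutation sends each \<open>s\<close> to
  \<open>s\<close> or to \<open>f s\<close>, the latter only if \<open>a s\<close> is nonzero. If it
  moves \<open>v\<close>, injectivity makes it move the whole orbit, including a zero of
  \<open>a\<close>; so only the identity remains.\<close>

lemma det_incidence_acyclic:
  fixes f :: "'n::finite \<Rightarrow> 'n"
  assumes f: "\<And>s. f s \<noteq> s" and zero: "\<And>v. \<exists>s\<in>limit_set f v. a s = 0"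
  shows "det (incidence a f) = 1"
proof -
  have entry: "incidence a f $ s $ t = (if t = s then 1 else if t = f s then - a s else 0)" for s t
    using f[of s] by (auto simp: incidence_def axis_def)
  have "(\<Prod>s\<in>UNIV. incidence a f $ s $ p s) = 0" if pp: "p permutes UNIV" "p \<noteq> id" for p
  proof (rule ccontr)
    assume "(\<Prod>s\<in>UNIV. incidence a f $ s $ p s) \<noteq> 0"
    then have "incidence a f $ s $ p s \<noteq> 0" for s
      by simp
    then have nz: "p s = s \<or> p s = f s \<and> a s \<noteq> 0" for s
      unfolding entry by (metis neg_equal_0_iff_equal)
    obtain v where v: "p v \<noteq> v" using pp(2) by (auto simp: fun_eq_iff)
    have "p ((f ^^ k) v) \<noteq> (f ^^ k) v" for k
    proof (induction k)
      case (Suc k)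
      have "p (p ((f ^^ k) v)) \<noteq> p ((f ^^ k) v)"
        using Suc permutes_inj[OF pp(1)] by (auto dest: injD)
      then show ?case using Suc nz[of "(f ^^ k) v"] by simp
    qed (use v in simp)
    then have "a ((f ^^ k) v) \<noteq> 0" for k using nz by metis
    then show False using zero[of v] by (metis limit_set_reachable)
  qed
  then have "det (incidence a f) = (\<Sum>p\<in>{id}. of_int (sign p) * (\<Prod>s\<in>UNIV. incidence a f $ s $ p s))"
    unfolding det_def by (intro sum.mono_neutral_right) (auto simp: permutes_id)
  then show ?thesis by (simp add: entry sign_id)
qed

text \<open>Row \<open>s\<close> can be cleared up to a multiple of the unit vector by telescoping along the
  orbit of \<open>s\<close>.\<close>

lemma det_incidence_cut:
  fixes f :: "'n::finite \<Rightarrow> 'n"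
  assumes s: "s \<in> limit_set f v"
  shows "det (incidence a f) =
    (1 - (\<Prod>x\<in>limit_set f v. a x)) * det (incidence (a(s := 0)) f)"
proof -
  obtain r where r: "0 < r" "(f ^^ r) s = s" "inj_on (\<lambda>i. (f ^^ i) s) {..<r}"
    "limit_set f v = (\<lambda>i. (f ^^ i) s) ` {..<r}"
    by (rule limit_set_enumerate[OF s])
  define A where "A = incidence a f"
  define c where "c k = (\<Prod>i<k. a ((f ^^ i) s))" for k
  have row: "row t A = axis t 1 - a t *s axis (f t) 1" for t
    by (simp add: A_def incidence_def row_def vec_eq_iff)
  \<comment> \<open>Index 0, which is row \<open>s\<close> itself, is left out, so \<open>x\<close>
    is a combination of other rows and adding it to row \<open>s\<close> keeps the
    determinant.\<close>
  define x where "x = (\<Sum>k\<in>{1..<r}. c k *s row ((f ^^ k) s) A)"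
  have x: "x \<in> vec.span {row j A |j. j \<noteq> s}"
    unfolding x_def
  proof (intro vec.span_sum vec.span_scale vec.span_base)
    fix k assume "k \<in> {1..<r}"
    then have "(f ^^ k) s \<noteq> (f ^^ 0) s" using r(1) inj_onD[OF r(3), of k 0] by auto
    then show "row ((f ^^ k) s) A \<in> {row j A |j. j \<noteq> s}" by auto
  qed
  have tele: "(\<Sum>k<m. c k *s row ((f ^^ k) s) A) = axis s 1 - c m *s axis ((f ^^ m) s) 1" for m
    by (induction m) (simp_all add: row c_def vec_eq_iff algebra_simps)
  have "row s A + x = (\<Sum>k<r. c k *s row ((f ^^ k) s) A)"
  proof -
    have "{..<r} = insert 0 {1..<r}" using r(1) by auto
    then show ?thesis by (simp add: x_def c_def)
  qed
  also have "\<dots> = (1 - c r) *s axis s 1"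
    by (simp add: tele r(2) vec_eq_iff algebra_simps)
  also have "c r = (\<Prod>x\<in>limit_set f v. a x)"
    unfolding c_def r(4) by (subst prod.reindex[OF r(3)]) simp
  finally have rowx: "row s A + x = (1 - (\<Prod>x\<in>limit_set f v. a x)) *s axis s 1" .
  have "det A = det (\<chi> k. if k = s then row s A + x else row k A)"
    using det_row_span[OF x] by simp
  also have "\<dots> = (1 - (\<Prod>x\<in>limit_set f v. a x)) * det (\<chi> k. if k = s then axis s 1 else row k A)"
    unfolding rowx by (rule det_row_mul)
  \<comment> \<open>With coefficient 0 at \<open>s\<close>, row \<open>s\<close> of the incidence
    matrix is exactly the unit vector.\<close>
  also have "(\<chi> k. if k = s then axis s 1 else row k A) = incidence (a(s := 0)) f"
    unfolding row by (simp add: incidence_def vec_eq_iff)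
  finally show ?thesis by (simp add: A_def)
qed

text \<open>Cutting every cycle at one vertex splits off one factor per cycle and leaves the acyclic
  case, of determinant 1.\<close>

lemma det_incidence:
  fixes f :: "'n::finite \<Rightarrow> 'n"
  assumes f: "\<And>s. f s \<noteq> s"
  shows "det (incidence a f) = (\<Prod>X\<in>range (limit_set f). 1 - (\<Prod>x\<in>X. a x))"
proof -
  \<comment> \<open>\<open>\<A>\<close> holds the cycles not yet cut; \<open>a\<close> has to vary,
    since each cut changes it.\<close>
  have *: "det (incidence a f) = (\<Prod>X\<in>\<A>. 1 - (\<Prod>x\<in>X. a x))"
    if "finite \<A>" "\<A> \<subseteq> range (limit_set f)" "\<And>v. limit_set f v \<notin> \<A> \<Longrightarrow> \<exists>s\<in>limit_set f v. a s = 0"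
    for \<A> a
    using that
  proof (induction \<A> arbitrary: a rule: finite_induct)
    case empty
    then show ?case using f by (simp add: det_incidence_acyclic)
  next
    case (insert X \<A>)
    then obtain v where v: "X = limit_set f v" by auto
    obtain s where s: "s \<in> limit_set f v" using limit_set_nonempty by blast
    have "det (incidence (a(s := 0)) f) = (\<Prod>X\<in>\<A>. 1 - (\<Prod>x\<in>X. (a(s := 0)) x))"
    proof (rule insert.IH)
      show "\<A> \<subseteq> range (limit_set f)" using insert.prems(1) by simp
      show "\<exists>t\<in>limit_set f u. (a(s := 0)) t = 0" if "limit_set f u \<notin> \<A>" for u
      proof (cases "limit_set f u = X")
        case True
        then show ?thesis using s v by auto
      next
        case False
        then show ?thesis using insert.prems(2)[of u] that by auto
      qed
    qed
    also have "\<dots> = (\<Prod>X\<in>\<A>. 1 - (\<Prod>x\<in>X. a x))"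
    proof (rule prod.cong[OF refl])
      fix Y assume "Y \<in> \<A>"
      then obtain y where "Y = limit_set f y" "Y \<noteq> X"
        using insert.hyps(2) insert.prems(1) by blast
      \<comment> \<open>Distinct limit sets are disjoint, so the cut at \<open>s\<close> leaves the
        factors of the other cycles alone.\<close>
      then have "s \<notin> Y"
        using s v limit_set_of_member[of s f y] limit_set_of_member[of s f v] by auto
      then show "1 - (\<Prod>x\<in>Y. (a(s := 0)) x) = 1 - (\<Prod>x\<in>Y. a x)"
        by (metis (no_types, lifting) fun_upd_apply prod.cong)
    qed
    finally show ?case using det_incidence_cut[OF s, of a] insert.hyps v by simp
  qed
  show ?thesis by (rule *) auto
qed

section \<open>Expansion of the gain Laplacian over functions\<close>

lemma det_cnj:
  fixes A :: "complex^'n^'n::finite"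
  shows "det (\<chi> i j. cnj (A $ i $ j)) = cnj (det A)"
  by (simp add: det_def)

text \<open>The weight is an arbitrary function on pairs because two choices are needed: graph
  distances, and the indicator of the edges of a forest.\<close>

definition gain_laplacian :: "('n \<Rightarrow> 'n \<Rightarrow> complex) \<Rightarrow> ('n set \<Rightarrow> complex) \<Rightarrow> complex^'n^'n::finite" where
  "gain_laplacian g w = (\<chi> s t. if s = t then \<Sum>u\<in>-{s}. w {s, u} else - (g s t * w {s, t}))"

text \<open>The rows of \<open>s\<close> and \<open>f s\<close> are proportional, since the gains of
  the two directions are inverse to each other.\<close>

lemma det_incidence_two_cycle:
  fixes f :: "'n::finite \<Rightarrow> 'n"
  assumes g: "\<And>s t. s \<noteq> t \<Longrightarrow> g s t * g t s = 1" and "f s \<noteq> s" "f (f s) = s"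
  shows "det (incidence (\<lambda>s. g s (f s)) f) = 0"
proof -
  let ?A = "incidence (\<lambda>s. g s (f s)) f"
  have row: "row t ?A = axis t 1 - g t (f t) *s axis (f t) 1" for t
    by (simp add: incidence_def row_def vec_eq_iff)
  let ?x = "g s (f s) *s row (f s) ?A"
  have x: "?x \<in> vec.span {row j ?A |j. j \<noteq> s}"
    using assms(2) by (intro vec.span_scale vec.span_base) auto
  have "det ?A = det (\<chi> k. if k = s then row s ?A + ?x else row k ?A)"
    using det_row_span[OF x] by simp
  also have "row s ?A + ?x = 0"
    unfolding row using assms g[of s "f s"] by (simp add: vec_eq_iff algebra_simps flip: mult.assoc)
  finally have "det ?A = det (\<chi> k. if k = s then 0 else row k ?A)" .
  moreover have "row s (\<chi> k. if k = s then 0 else row k ?A) = 0"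
    by (simp add: row_def vec_eq_iff)
  ultimately show ?thesis by (simp only: det_zero_row(2))
qed

lemma inj_functional_edge:
  assumes "no_short_cycles f"
  shows "inj (\<lambda>s. {s, f s})"
proof (rule injI)
  fix s t assume "{s, f s} = {t, f t}"
  then have "s = t \<or> f (f s) = s" by (auto simp only: doubleton_eq_iff)
  then show "s = t" using assms unfolding no_short_cycles_def by blast
qed

text \<open>Choosing the summand \<open>t = f s\<close> in each row \<open>s\<close> expands the
  determinant over functions \<open>f\<close>. Injectivity of the map from vertices to edges then
  turns the product over vertices into one over edges.\<close>

lemma det_gain_laplacian_functions:
  fixes g :: "'n::finite \<Rightarrow> 'n \<Rightarrow> complex"
  assumes g: "\<And>s t. s \<noteq> t \<Longrightarrow> g s t * g t s = 1"
  shows "det (gain_laplacian g w) =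
    (\<Sum>f | no_short_cycles f. (\<Prod>e\<in>functional_edges f. w e) * det (incidence (\<lambda>s. g s (f s)) f))"
proof -
  \<comment> \<open>The zero on the diagonal lets every row sum run over the whole type, and it
    kills the functions with a fixed point.\<close>
  define w' where "w' s t = (if s = t then 0 else w {s, t})" for s t
  have "gain_laplacian g w = (\<chi> s. \<Sum>t\<in>UNIV. w' s t *s (axis s 1 - g s t *s axis t 1))"
  proof -
    have "gain_laplacian g w $ s $ t = (\<Sum>u\<in>UNIV. w' s u * ((if t = s then 1 else 0) - g s u * (if t = u then 1 else 0)))"
      for s t
    proof -
      have "(\<Sum>u\<in>UNIV. w' s u) = (\<Sum>u\<in>-{s}. w {s, u})"
        unfolding w'_def by (rule sum.mono_neutral_cong_right) auto
      moreover have "(\<Sum>u\<in>UNIV. w' s u * (g s u * (if t = u then 1 else 0))) = w' s t * g s t"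
        by (simp add: if_distrib cong: if_cong)
      moreover have "w' s s = 0" by (simp add: w'_def)
      moreover have "w' s t = w {s, t}" if "s \<noteq> t" using that by (simp add: w'_def)
      ultimately show ?thesis
        by (auto simp: gain_laplacian_def right_diff_distrib sum_subtractf)
    qed
    then show ?thesis by (simp add: vec_eq_iff axis_def mult.assoc right_diff_distrib)
  qed
  then have "det (gain_laplacian g w) =
      (\<Sum>f\<in>UNIV. det (\<chi> s. w' s (f s) *s (axis s 1 - g s (f s) *s axis (f s) 1)))"
    using det_linear_rows_sum[of UNIV "\<lambda>s t. w' s t *s (axis s 1 - g s t *s axis t 1)"] by simp
  also have "\<dots> = (\<Sum>f\<in>UNIV. (\<Prod>s\<in>UNIV. w' s (f s)) * det (incidence (\<lambda>s. g s (f s)) f))"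
    unfolding det_rows_mul incidence_def ..
  also have "\<dots> = (\<Sum>f | no_short_cycles f. (\<Prod>s\<in>UNIV. w' s (f s)) * det (incidence (\<lambda>s. g s (f s)) f))"
  proof (rule sum.mono_neutral_right)
    show "\<forall>f\<in>UNIV - Collect no_short_cycles.
        (\<Prod>s\<in>UNIV. w' s (f s)) * det (incidence (\<lambda>s. g s (f s)) f) = 0"
    proof
      fix f :: "'n \<Rightarrow> 'n" assume "f \<in> UNIV - Collect no_short_cycles"
      then consider s where "f s = s" | s where "f s \<noteq> s" "f (f s) = s"
        by (auto simp: no_short_cycles_def)
      then show "(\<Prod>s\<in>UNIV. w' s (f s)) * det (incidence (\<lambda>s. g s (f s)) f) = 0"
      proof cases
        case 1
        then have "w' s (f s) = 0" by (simp add: w'_def)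
        then show ?thesis using prod_zero[of UNIV "\<lambda>s. w' s (f s)"] by auto
      next
        case 2
        then show ?thesis using det_incidence_two_cycle[of g, OF g] by simp
      qed
    qed
  qed auto
  also have "\<dots> = (\<Sum>f | no_short_cycles f. (\<Prod>e\<in>functional_edges f. w e) * det (incidence (\<lambda>s. g s (f s)) f))"
  proof (rule sum.cong[OF refl])
    fix f :: "'n \<Rightarrow> 'n" assume "f \<in> Collect no_short_cycles"
    then have f: "no_short_cycles f" by simp
    have "(\<Prod>e\<in>functional_edges f. w e) = (\<Prod>s\<in>UNIV. w {s, f s})"
      unfolding functional_edges_def by (simp add: prod.reindex[OF inj_functional_edge[OF f]])
    also have "\<dots> = (\<Prod>s\<in>UNIV. w' s (f s))"
      using f by (intro prod.cong) (auto simp: w'_def no_short_cycles_def dest: sym)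
    finally show "(\<Prod>s\<in>UNIV. w' s (f s)) * det (incidence (\<lambda>s. g s (f s)) f) =
        (\<Prod>e\<in>functional_edges f. w e) * det (incidence (\<lambda>s. g s (f s)) f)" by simp
  qed
  finally show ?thesis .
qed

lemma edge_in_functional_edges:
  "{s, t} \<in> functional_edges f \<longleftrightarrow> t = f s \<or> s = f t"
  by (auto simp: functional_edges_def doubleton_eq_iff)

section \<open>Summation over functions with the same edge set\<close>

lemma card_functional_edges:
  fixes f :: "'n::finite \<Rightarrow> 'n"
  assumes "no_short_cycles f"
  shows "card (functional_edges f) = CARD('n)"
  unfolding functional_edges_def by (rule card_image[OF inj_functional_edge[OF assms]])

text \<open>Each edge belongs to exactly one row of \<open>B\<close>, and that row contributes the 2
  by 2 block of the edge in the Laplacian.\<close>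

lemma incidence_gram:
  fixes g :: "'n::finite \<Rightarrow> 'n \<Rightarrow> complex"
  assumes g: "\<And>s t. s \<noteq> t \<Longrightarrow> cmod (g s t) = 1" "\<And>s t. s \<noteq> t \<Longrightarrow> g t s = cnj (g s t)"
    and f: "no_short_cycles f"
  defines "B \<equiv> incidence (\<lambda>s. g s (f s)) f"
  shows "transpose (\<chi> i j. cnj (B $ i $ j)) ** B =
    gain_laplacian g (\<lambda>e. if e \<in> functional_edges f then 1 else 0)"
proof -
  have f1: "f s \<noteq> s" "s \<noteq> f s" "f (f s) \<noteq> s" "s \<noteq> f (f s)" for s
    using f unfolding no_short_cycles_def by metis+
  have B: "B $ u $ t = (if u = t then 1 else 0) - (if f u = t then g u t else 0)" for u t
    by (auto simp: B_def incidence_def axis_def)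
  have unit: "cnj (g s t) * g s t = 1" if "s \<noteq> t" for s t
    using g(1)[OF that] complex_norm_square[of "g s t"] by (simp add: mult.commute)
  have "(\<Sum>u\<in>UNIV. cnj (B $ u $ s) * B $ u $ t) =
      (if s = t then \<Sum>u\<in>-{s}. if {s, u} \<in> functional_edges f then 1 else 0
       else - (g s t * (if {s, t} \<in> functional_edges f then 1 else 0)))" for s t
  proof (cases "s = t")
    case True
    have "(\<Sum>u\<in>UNIV. cnj (B $ u $ s) * B $ u $ s) =
        (\<Sum>u\<in>UNIV. (if u = s then 1 else 0) + (if f u = s then 1 else 0))"
      using unit by (intro sum.cong) (auto simp: B f1)
    \<comment> \<open>The unit at \<open>u = s\<close> is moved to \<open>u = f s\<close>: the
      summands then count neighbours \<open>u\<close> of \<open>s\<close> instead of rows.\<close>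
    also have "\<dots> = (\<Sum>u\<in>UNIV. (if u = f s then 1 else 0) + (if f u = s then 1 else 0))"
      by (simp add: sum.distrib)
    also have "\<dots> = (\<Sum>u\<in>UNIV. if {s, u} \<in> functional_edges f then 1 else 0)"
      by (intro sum.cong) (auto simp: edge_in_functional_edges f1)
    also have "\<dots> = (\<Sum>u\<in>-{s}. if {s, u} \<in> functional_edges f then 1 else 0)"
      using f1 edge_in_functional_edges[of s s f] by (intro sum.mono_neutral_right) auto
    finally show ?thesis using True by simp
  next
    case False
    \<comment> \<open>Row \<open>u\<close> is supported on \<open>u\<close> and \<open>f u\<close>,
      so only rows \<open>s\<close> and \<open>t\<close> can meet both columns.\<close>
    have "(\<Sum>u\<in>UNIV. cnj (B $ u $ s) * B $ u $ t) =
        (\<Sum>u\<in>UNIV. (if u = s then - (if f s = t then g s t else 0) else 0) +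
                    (if u = t then - (if f t = s then g s t else 0) else 0))"
      using False g(2)[of t s] by (intro sum.cong) (auto simp: B)
    also have "\<dots> = - (if f s = t then g s t else 0) - (if f t = s then g s t else 0)"
      by (simp add: sum.distrib)
    also have "\<dots> = - (g s t * (if {s, t} \<in> functional_edges f then 1 else 0))"
      using f1 by (auto simp: edge_in_functional_edges)
    finally show ?thesis using False by simp
  qed
  then show ?thesis
    by (simp only: vec_eq_iff gain_laplacian_def matrix_matrix_mult_def transpose_def vec_lambda_beta) simp
qed

text \<open>Evaluating the determinant of the unit-weight Laplacian of \<open>functional_edges f\<close> both by
  the expansion over functions and as a Gram determinant sums the contributions of all
  orientations at once.\<close>

lemma sum_det_incidence_same_edges:
  fixes g :: "'n::finite \<Rightarrow> 'n \<Rightarrow> complex"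
  assumes g: "\<And>s t. s \<noteq> t \<Longrightarrow> cmod (g s t) = 1" "\<And>s t. s \<noteq> t \<Longrightarrow> g t s = cnj (g s t)"
    and f: "no_short_cycles f"
  shows "(\<Sum>h | no_short_cycles h \<and> functional_edges h = functional_edges f.
      det (incidence (\<lambda>s. g s (h s)) h)) =
    of_real ((cmod (det (incidence (\<lambda>s. g s (f s)) f)))\<^sup>2)"
proof -
  let ?F = "functional_edges f"
  let ?d = "\<lambda>h. det (incidence (\<lambda>s. g s (h s)) h)"
  let ?w = "\<lambda>e. if e \<in> ?F then 1 else 0 :: complex"
  have inv: "g s t * g t s = 1" if "s \<noteq> t" for s t
    using g[OF that] complex_norm_square[of "g s t"] by simp
  \<comment> \<open>An \<open>h\<close> with an edge outside \<open>?F\<close> gets weight 0;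
    otherwise its edge set lies in \<open>?F\<close> and has the same cardinality, hence equals
    it.\<close>
  have "(\<Prod>e\<in>functional_edges h. ?w e) = (if functional_edges h = ?F then 1 else 0)"
    if h: "no_short_cycles h" for h
  proof (cases "functional_edges h \<subseteq> ?F")
    case True
    then have "functional_edges h = ?F"
      using card_functional_edges[OF f] card_functional_edges[OF h] by (intro card_subset_eq) auto
    then show ?thesis by simp
  next
    case False
    then show ?thesis by (auto intro!: prod_zero)
  qed
  then have "(\<Sum>h | no_short_cycles h. (\<Prod>e\<in>functional_edges h. ?w e) * ?d h) =
      (\<Sum>h | no_short_cycles h. (if functional_edges h = ?F then 1 else 0) * ?d h)"
    by (intro sum.cong refl) simp
  then have "det (gain_laplacian g ?w) =
      (\<Sum>h | no_short_cycles h. (if functional_edges h = ?F then 1 else 0) * ?d h)"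
    using det_gain_laplacian_functions[of g ?w, OF inv] by simp
  also have "\<dots> = (\<Sum>h | no_short_cycles h \<and> functional_edges h = ?F. ?d h)"
    by (rule sum.mono_neutral_cong_right) auto
  finally have "(\<Sum>h | no_short_cycles h \<and> functional_edges h = ?F. ?d h) = cnj (?d f) * ?d f"
    by (simp add: incidence_gram[OF g f, symmetric] det_mul det_transpose det_cnj)
  then show ?thesis by (metis complex_norm_square mult.commute)
qed

section \<open>Components and cycles of functional graphs\<close>

definition adjacency :: "'a set set \<Rightarrow> ('a \<times> 'a) set" where
  "adjacency E = {(x, y). {x, y} \<in> E}"

definition component :: "'a set set \<Rightarrow> 'a \<Rightarrow> 'a set" where
  "component E v = {u. (v, u) \<in> (adjacency E)\<^sup>*}"

lemma sym_rtrancl_adjacency: "sym ((adjacency E)\<^sup>*)"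
  by (rule sym_rtrancl) (auto simp: sym_def adjacency_def insert_commute)

lemma rtrancl_adjacency_commute: "(u, v) \<in> (adjacency E)\<^sup>* \<longleftrightarrow> (v, u) \<in> (adjacency E)\<^sup>*"
  by (metis sym_rtrancl_adjacency symE)

lemma component_eq_iff: "component E u = component E v \<longleftrightarrow> (u, v) \<in> (adjacency E)\<^sup>*"
proof
  assume "component E u = component E v"
  moreover have "v \<in> component E v" by (simp add: component_def)
  ultimately show "(u, v) \<in> (adjacency E)\<^sup>*" by (auto simp: component_def)
next
  assume "(u, v) \<in> (adjacency E)\<^sup>*"
  then show "component E u = component E v"
    unfolding component_def using rtrancl_adjacency_commute[of u v E] by (blast intro: rtrancl_trans)
qed

lemma component_self: "v \<in> component E v"
  by (simp add: component_def)

lemma component_member: "u \<in> component E v \<Longrightarrow> component E u = component E v"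
  by (metis component_def component_eq_iff mem_Collect_eq)

lemma component_edge: "{u, v} \<in> E \<Longrightarrow> component E u = component E v"
  unfolding component_eq_iff by (auto simp: adjacency_def)

lemma successively_reachable:
  assumes "successively (\<lambda>x y. {x, y} \<in> E) p" "x \<in> set p"
  shows "(hd p, x) \<in> (adjacency E)\<^sup>*"
  using assms
proof (induction p rule: induct_list012)
  case (3 a b p)
  then have "(a, b) \<in> adjacency E" by (simp add: adjacency_def)
  with 3 show ?case by (auto intro: converse_rtrancl_into_rtrancl)
qed auto

lemma path_of_reachable:
  assumes "(u, v) \<in> (adjacency E)\<^sup>*"
  shows "\<exists>p. path_between UNIV E u v p"
  using assms
proof (induction rule: rtrancl_induct)
  case base
  have "path_between UNIV E u u [u]" by (simp add: path_between_def)
  then show ?case ..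
next
  case (step y z)
  then obtain p where p: "path_between UNIV E u y p" by blast
  show ?case
  proof (cases "z \<in> set p")
    \<comment> \<open>If the new vertex already lies on the path, the path is cut off there to stay
      distinct.\<close>
    case True
    then obtain q r where "p = q @ z # r" by (meson split_list)
    then have "path_between UNIV E u z (q @ [z])"
      using p by (auto simp: path_between_def successively_append_iff hd_append split: if_splits)
    then show ?thesis ..
  next
    case False
    then have "path_between UNIV E u z (p @ [z])"
      using p step(2) by (auto simp: path_between_def successively_append_iff adjacency_def)
    then show ?thesis ..
  qed
qed

lemma path_between_iff_reachable:
  "(\<exists>p. path_between UNIV E u v p) \<longleftrightarrow> (u, v) \<in> (adjacency E)\<^sup>*"
proof
  assume "\<exists>p. path_between UNIV E u v p"
  then show "(u, v) \<in> (adjacency E)\<^sup>*"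
    by (metis path_between_def last_in_set successively_reachable)
qed (rule path_of_reachable)

lemma graph_components_UNIV: "graph_components UNIV E = range (component E)"
  by (auto simp: graph_components_def component_def path_between_iff_reachable)

text \<open>A path of the whole graph never leaves the component of its start, so it is a path of
  the induced subgraph too.\<close>

lemma connected_component:
  "connected_graph (component E v) {e \<in> E. e \<subseteq> component E v}"
  unfolding connected_graph_def
proof (intro ballI)
  let ?W = "component E v"
  fix x y assume xy: "x \<in> ?W" "y \<in> ?W"
  then have "(x, y) \<in> (adjacency E)\<^sup>*" by (metis component_eq_iff component_member)
  then obtain p where p: "path_between UNIV E x y p" using path_of_reachable by metis
  have W: "set p \<subseteq> ?W"
  proof
    fix z assume "z \<in> set p"
    then have "(x, z) \<in> (adjacency E)\<^sup>*"
      using p successively_reachable unfolding path_between_def by metis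
    then show "z \<in> ?W" using xy(1) by (metis component_eq_iff component_member component_self)
  qed
  have "successively (\<lambda>x y. {x, y} \<in> {e \<in> E. e \<subseteq> ?W}) p"
    using p W by (auto simp: path_between_def elim!: successively_mono)
  then have "path_between ?W {e \<in> E. e \<subseteq> ?W} x y p"
    using p W by (simp add: path_between_def)
  then show "\<exists>p. path_between ?W {e \<in> E. e \<subseteq> ?W} x y p" ..
qed

section \<open>Cycles of functional graphs\<close>

lemma traverses_cycle_nth_mod:
  assumes "traverses_cycle c C"
  shows "{c ! (i mod length c), c ! (Suc i mod length c)} \<in> C"
    and "c ! (i mod length c) \<in> set c"
    and "c ! (i mod length c) \<noteq> c ! (Suc i mod length c)"
    and "c ! (i mod length c) \<noteq> c ! (Suc (Suc i) mod length c)"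
proof -
  have r: "3 \<le> length c" and d: "distinct c" and C: "C = cycle_edges c"
    using assms by (auto simp: traverses_cycle_def)
  have l: "j mod length c < length c" for j using r by (intro mod_less_divisor) auto
  show "{c ! (i mod length c), c ! (Suc i mod length c)} \<in> C"
    unfolding C cycle_edges_def using l[of i] by (auto intro!: exI[of _ "i mod length c"] simp: mod_Suc_eq)
  show "c ! (i mod length c) \<in> set c" using l by simp
  \<comment> \<open>Length at least 3 keeps indices two apart from coinciding; this later rules out
    2-cycles.\<close>
  have "i mod length c \<noteq> Suc i mod length c" "i mod length c \<noteq> Suc (Suc i) mod length c"
    using r by (auto simp: mod_Suc)
  then show "c ! (i mod length c) \<noteq> c ! (Suc i mod length c)"
    "c ! (i mod length c) \<noteq> c ! (Suc (Suc i) mod length c)"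
    using d l by (simp_all add: nth_eq_iff_index_eq)
qed

lemma set_conv_nth_mod:
  assumes "x \<in> set c"
  obtains i where "x = c ! (i mod length c)"
  using assms by (metis in_set_conv_nth mod_less)

text \<open>Each edge of a cycle in \<open>functional_edges f\<close> is \<open>{s, f s}\<close> for one of its two ends; if
  an edge is traversed in the direction of \<open>f\<close>, so must be the one before it.\<close>

lemma functional_cycle_orientation:
  assumes c: "traverses_cycle c C" and C: "C \<subseteq> functional_edges f"
  shows "(\<forall>i. f (c ! (i mod length c)) = c ! (Suc i mod length c)) \<or>
         (\<forall>i. f (c ! (Suc i mod length c)) = c ! (i mod length c))"
proof -
  define D where "D i = c ! (i mod length c)" for i
  have D: "D (Suc i) = f (D i) \<or> D i = f (D (Suc i))" "D i \<noteq> D (Suc (Suc i))" for i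
    using traverses_cycle_nth_mod[OF c, of i] C
    by (auto simp: D_def edge_in_functional_edges[symmetric])
  have per: "D (i + length c * m) = D i" for i m by (simp add: D_def)
  \<comment> \<open>\<open>f (D (Suc i))\<close> cannot be \<open>D i\<close> as well, because
    vertices two steps apart differ; so edge \<open>i\<close> runs forward.\<close>
  have bwd: "f (D i) = D (Suc i)" if "f (D (Suc i)) = D (Suc (Suc i))" for i
    using D[of i] that by metis
  have "f (D i) = D (Suc i)" if j: "f (D j) = D (Suc j)" for i j
  proof -
    \<comment> \<open>The direction spreads only backwards, so periodicity first carries the forward
      edge to an index not below \<open>i\<close>.\<close>
    have edge: "f (D (j + length c * i)) = D (Suc (j + length c * i))"
      using j per[of j i] per[of "Suc j" i] by simp
    have "i \<le> j + length c * i"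
      using c by (cases "length c") (auto simp: traverses_cycle_def)
    from this edge show ?thesis by (rule inc_induct) (rule bwd)
  qed
  then have "(\<forall>i. f (D i) = D (Suc i)) \<or> (\<forall>i. f (D (Suc i)) = D i)"
    using D(1) by metis
  then show ?thesis by (simp add: D_def)
qed

lemma functional_cycle_step:
  assumes c: "traverses_cycle c C" and C: "C \<subseteq> functional_edges f" and "x \<in> set c"
  shows "f x \<in> set c"
proof -
  obtain i where "x = c ! (i mod length c)" using assms(3) by (rule set_conv_nth_mod)
  \<comment> \<open>For the reversed direction \<open>x\<close> must appear as a successor; adding
    the length before subtracting 1 avoids truncation at \<open>i = 0\<close>.\<close>
  moreover have "c ! (i mod length c) = c ! (Suc (i + length c - 1) mod length c)"
  proof -
    have "0 < length c" using c by (auto simp: traverses_cycle_def)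
    then have "Suc (i + length c - 1) = i + length c" by linarith
    then show ?thesis by simp
  qed
  ultimately show ?thesis
    using functional_cycle_orientation[OF c C] traverses_cycle_nth_mod(2)[OF c] by metis
qed

text \<open>The vertices of the cycle are closed under \<open>f\<close>, so they contain the limit
  set; \<open>f\<close> runs all the way round in one direction, so none is missed.\<close>

lemma functional_cycle_limit_set:
  fixes x :: "'n::finite"
  assumes c: "traverses_cycle c C" and C: "C \<subseteq> functional_edges f" and x: "x \<in> set c"
  shows "limit_set f x = set c"
proof
  have "(f ^^ k) x \<in> set c" for k
    using x by (induction k) (auto intro: functional_cycle_step[OF c C])
  then show sub: "limit_set f x \<subseteq> set c" by (auto elim: limit_set_reachable)
  define D where "D i = c ! (i mod length c)" for i
  have per: "D (i + length c * m) = D i" for i m by (simp add: D_def)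
  have le: "i \<le> j + length c * i" for i j
    using c by (cases "length c") (auto simp: traverses_cycle_def)
  obtain y where "y \<in> limit_set f x" using limit_set_nonempty[of f x] by blast
  then obtain j where j: "D j \<in> limit_set f x"
    using sub set_conv_nth_mod[of y c] by (metis D_def subsetD)
  have "D i \<in> limit_set f x" for i
    using functional_cycle_orientation[OF c C]
  proof
    assume "\<forall>i. f (c ! (i mod length c)) = c ! (Suc i mod length c)"
    then have up: "D i \<in> limit_set f x \<Longrightarrow> D (Suc i) \<in> limit_set f x" for i
      using limit_set_closed[of "D i" f x] by (simp add: D_def)
    have "D (i + length c * j) \<in> limit_set f x"
      using le[of j i] j by (rule dec_induct) (rule up)
    then show ?thesis by (simp only: per)
  next
    assume "\<forall>i. f (c ! (Suc i mod length c)) = c ! (i mod length c)"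
    then have down: "D (Suc i) \<in> limit_set f x \<Longrightarrow> D i \<in> limit_set f x" for i
      using limit_set_closed[of "D (Suc i)" f x] by (simp add: D_def)
    have "D (j + length c * i) \<in> limit_set f x" using j by (simp only: per)
    from le[of i j] this show "D i \<in> limit_set f x"
      by (rule inc_induct) (rule down)
  qed
  then show "set c \<subseteq> limit_set f x"
    by (metis D_def set_conv_nth_mod subsetI)
qed

lemma prod_set_conv_nth:
  assumes "distinct xs"
  shows "(\<Prod>x\<in>set xs. h x) = (\<Prod>i<length xs. h (xs ! i))"
proof -
  have "set xs = (!) xs ` {..<length xs}" by (auto simp: set_conv_nth)
  then show ?thesis using assms by (simp add: prod.reindex inj_on_nth)
qed

lemma functional_cycle_edges:
  assumes c: "traverses_cycle c C" and C: "C \<subseteq> functional_edges f"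
  shows "C = (\<lambda>s. {s, f s}) ` set c"
proof -
  have Ceq: "C = (\<lambda>i. {c ! i, c ! (Suc i mod length c)}) ` {..<length c}"
    using c by (auto simp: traverses_cycle_def cycle_edges_def)
  from functional_cycle_orientation[OF c C] show ?thesis
  proof
    assume up: "\<forall>i. f (c ! (i mod length c)) = c ! (Suc i mod length c)"
    have "f (c ! i) = c ! (Suc i mod length c)" if "i < length c" for i
      using up[rule_format, of i] that by simp
    moreover have "set c = (!) c ` {..<length c}" by (auto simp: set_conv_nth)
    ultimately show ?thesis unfolding Ceq by (auto simp: image_image)
  next
    assume down: "\<forall>i. f (c ! (Suc i mod length c)) = c ! (i mod length c)"
    \<comment> \<open>When \<open>f\<close> runs against \<open>c\<close>, edge \<open>i\<close> of
      \<open>c\<close> is the \<open>f\<close>-edge of its second end, which is entry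
      \<open>i\<close> of \<open>rotate1 c\<close>.\<close>
    have "f (rotate1 c ! i) = c ! i" if "i < length c" for i
      using down[rule_format, of i] that by (simp add: nth_rotate1)
    moreover have "set c = (!) (rotate1 c) ` {..<length c}"
      using set_conv_nth[of "rotate1 c"] by auto
    ultimately show ?thesis unfolding Ceq
      by (auto simp: image_image nth_rotate1 insert_commute)
  qed
qed

text \<open>\<open>f\<close> may run against \<open>c\<close>, and reversal conjugates every gain.
  The real part is unaffected, so any orientation of the cycle will do.\<close>

lemma functional_cycle_gain:
  assumes g: "\<And>s t. s \<noteq> t \<Longrightarrow> g t s = cnj (g s t)"
    and c: "traverses_cycle c C" and C: "C \<subseteq> functional_edges f"
  shows "(\<Prod>s\<in>set c. g s (f s)) \<in> {cycle_gain g c, cnj (cycle_gain g c)}"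
proof -
  have d: "distinct c" using c by (simp add: traverses_cycle_def)
  from functional_cycle_orientation[OF c C] show ?thesis
  proof
    assume up: "\<forall>i. f (c ! (i mod length c)) = c ! (Suc i mod length c)"
    have "f (c ! i) = c ! (Suc i mod length c)" if "i < length c" for i
      using up[rule_format, of i] that by simp
    then show ?thesis by (simp add: prod_set_conv_nth[OF d] cycle_gain_def)
  next
    assume down: "\<forall>i. f (c ! (Suc i mod length c)) = c ! (i mod length c)"
    have "(\<Prod>s\<in>set (rotate1 c). g s (f s)) = (\<Prod>i<length c. g (rotate1 c ! i) (f (rotate1 c ! i)))"
      using d by (subst prod_set_conv_nth) auto
    also have "\<dots> = (\<Prod>i<length c. cnj (g (c ! i) (c ! (Suc i mod length c))))"
    proof (rule prod.cong[OF refl])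
      fix i assume "i \<in> {..<length c}"
      then have i: "i mod length c = i" "rotate1 c ! i = c ! (Suc i mod length c)"
        by (auto simp: nth_rotate1)
      then have ne: "c ! i \<noteq> c ! (Suc i mod length c)" and fc: "f (c ! (Suc i mod length c)) = c ! i"
        using traverses_cycle_nth_mod(3)[OF c, of i] down by (metis)+
      from g[OF ne] show "g (rotate1 c ! i) (f (rotate1 c ! i)) = cnj (g (c ! i) (c ! (Suc i mod length c)))"
        unfolding i(2) fc .
    qed
    finally show ?thesis by (simp add: cycle_gain_def)
  qed
qed

text \<open>One period of the recurrent orbit is the vertex list; periods 1 and 2 are what
  \<open>no_short_cycles\<close> excludes.\<close>

lemma limit_set_cycle:
  assumes f: "no_short_cycles f"
  shows "\<exists>c. traverses_cycle c ((\<lambda>s. {s, f s}) ` limit_set f (v::'n::finite))"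
proof -
  obtain x where x: "x \<in> limit_set f v" using limit_set_nonempty[of f v] by blast
  obtain r where r: "0 < r" "(f ^^ r) x = x" "inj_on (\<lambda>i. (f ^^ i) x) {..<r}"
    "limit_set f v = (\<lambda>i. (f ^^ i) x) ` {..<r}"
    by (rule limit_set_enumerate[OF x])
  define c where "c = map (\<lambda>i. (f ^^ i) x) [0..<r]"
  have "r \<noteq> 1" "r \<noteq> 2"
    using r(2) f by (auto simp: no_short_cycles_def numeral_2_eq_2)
  with r(1) have "3 \<le> length c" by (simp add: c_def)
  moreover have "distinct c"
    using r(3) by (simp add: c_def distinct_map atLeast0LessThan)
  moreover have "cycle_edges c = (\<lambda>s. {s, f s}) ` limit_set f v"
  proof -
    have "c ! (Suc i mod length c) = f ((f ^^ i) x)" for i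
    proof -
      have "c ! (Suc i mod length c) = (f ^^ (Suc i mod r)) x"
        using r(1) by (simp add: c_def)
      also have "\<dots> = (f ^^ Suc i) x" using r(2) by (rule funpow_mod_eq)
      finally show ?thesis by simp
    qed
    moreover have "c ! i = (f ^^ i) x" if "i < r" for i using that by (simp add: c_def)
    moreover have "length c = r" by (simp add: c_def)
    ultimately have "cycle_edges c = (\<lambda>i. {(f ^^ i) x, f ((f ^^ i) x)}) ` {..<r}"
      unfolding cycle_edges_def setcompr_eq_image by (intro image_cong) auto
    then show ?thesis unfolding r(4) by (simp add: image_image)
  qed
  ultimately show ?thesis unfolding traverses_cycle_def by blast
qed

text \<open>Serves to turn the product over limit sets, into which the determinant factors, into one
  over unoriented cycles.\<close>

lemma graph_cycles_functional_edges:
  fixes f :: "'n::finite \<Rightarrow> 'n"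
  assumes f: "no_short_cycles f"
  shows "graph_cycles (functional_edges f) = (\<lambda>X. (\<lambda>s. {s, f s}) ` X) ` range (limit_set f)"
proof (intro equalityI subsetI)
  fix C assume "C \<in> graph_cycles (functional_edges f)"
  then obtain c where c: "traverses_cycle c C" "C \<subseteq> functional_edges f"
    by (auto simp: graph_cycles_def)
  then have "length c \<noteq> 0" by (auto simp: traverses_cycle_def)
  then have "c ! 0 \<in> set c" by simp
  then have "limit_set f (c ! 0) = set c" using functional_cycle_limit_set[OF c] by simp
  then show "C \<in> (\<lambda>X. (\<lambda>s. {s, f s}) ` X) ` range (limit_set f)"
    using functional_cycle_edges[OF c] by (metis rangeI imageI)
next
  fix C assume "C \<in> (\<lambda>X. (\<lambda>s. {s, f s}) ` X) ` range (limit_set f)"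
  then obtain v where C: "C = (\<lambda>s. {s, f s}) ` limit_set f v" by auto
  then show "C \<in> graph_cycles (functional_edges f)"
    using limit_set_cycle[OF f, of v] by (auto simp: graph_cycles_def functional_edges_def)
qed

lemma cmod_one_minus_unit:
  assumes "cmod z = 1"
  shows "(cmod (1 - z))\<^sup>2 = 2 * (1 - Re z)"
proof -
  have "(Re z)\<^sup>2 + (Im z)\<^sup>2 = 1" using assms by (simp add: cmod_def)
  moreover have "(cmod (1 - z))\<^sup>2 = (1 - Re z)\<^sup>2 + (Im z)\<^sup>2" by (simp add: cmod_power2)
  ultimately show ?thesis by (simp add: power2_diff)
qed

lemma cmod_det_incidence_cycles:
  fixes g :: "'n::finite \<Rightarrow> 'n \<Rightarrow> complex"
  assumes g: "\<And>s t. s \<noteq> t \<Longrightarrow> cmod (g s t) = 1" "\<And>s t. s \<noteq> t \<Longrightarrow> g t s = cnj (g s t)"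
    and f: "no_short_cycles f"
    and orient: "\<And>C. C \<in> graph_cycles (functional_edges f) \<Longrightarrow> traverses_cycle (orient C) C"
  shows "(cmod (det (incidence (\<lambda>s. g s (f s)) f)))\<^sup>2 =
    (\<Prod>C\<in>graph_cycles (functional_edges f). 2 * (1 - Re (cycle_gain g (orient C))))"
proof -
  have ne: "f s \<noteq> s" "s \<noteq> f s" for s using f unfolding no_short_cycles_def by metis+
  let ?E = "\<lambda>X. (\<lambda>s. {s, f s}) ` X"
  have inj: "inj_on ?E (range (limit_set f))"
    by (rule inj_onI) (simp only: inj_image_eq_iff[OF inj_functional_edge[OF f]])
  have "(cmod (det (incidence (\<lambda>s. g s (f s)) f)))\<^sup>2 =
      (\<Prod>X\<in>range (limit_set f). (cmod (1 - (\<Prod>s\<in>X. g s (f s))))\<^sup>2)"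
    by (simp add: det_incidence[OF ne(1)] prod_norm[symmetric] prod_power_distrib)
  also have "\<dots> = (\<Prod>X\<in>range (limit_set f). 2 * (1 - Re (cycle_gain g (orient (?E X)))))"
  proof (rule prod.cong[OF refl])
    fix X assume X: "X \<in> range (limit_set f)"
    let ?c = "orient (?E X)"
    have E: "?E X \<in> graph_cycles (functional_edges f)"
      using X unfolding graph_cycles_functional_edges[OF f] by blast
    then have sub: "?E X \<subseteq> functional_edges f" by (simp add: graph_cycles_def)
    have "?E (set ?c) = ?E X"
      using functional_cycle_edges[OF orient[OF E] sub] by simp
    then have "set ?c = X" by (simp only: inj_image_eq_iff[OF inj_functional_edge[OF f]])
    then have "(\<Prod>s\<in>X. g s (f s)) \<in> {cycle_gain g ?c, cnj (cycle_gain g ?c)}"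
      using functional_cycle_gain[of g, OF g(2) orient[OF E] sub] by simp
    then have "Re (\<Prod>s\<in>X. g s (f s)) = Re (cycle_gain g ?c)" by auto
    moreover have "cmod (\<Prod>s\<in>X. g s (f s)) = 1"
      by (simp add: prod_norm[symmetric] g(1) ne)
    ultimately show "(cmod (1 - (\<Prod>s\<in>X. g s (f s))))\<^sup>2 = 2 * (1 - Re (cycle_gain g ?c))"
      using cmod_one_minus_unit by metis
  qed
  finally show ?thesis
    by (simp add: graph_cycles_functional_edges[OF f] prod.reindex[OF inj])
qed

section \<open>Spanning 1-forests as functional graphs\<close>

lemma functional_edges_one_forest:
  fixes f :: "'n::finite \<Rightarrow> 'n"
  assumes f: "no_short_cycles f"
  shows "functional_edges f \<in> spanning_one_forests UNIV"
proof -
  let ?F = "functional_edges f"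
  have card: "card {s, f s} = 2" for s
    using f unfolding no_short_cycles_def by (metis card_2_iff)
  then have complete: "?F \<subseteq> complete_edges UNIV"
    by (auto simp: functional_edges_def complete_edges_def)
  have step: "component ?F (f s) = component ?F s" for s
    by (metis component_edge edge_in_functional_edges)
  have "one_tree (component ?F v) {e \<in> ?F. e \<subseteq> component ?F v}" for v
  proof -
    let ?W = "component ?F v" and ?G = "{e \<in> ?F. e \<subseteq> component ?F v}"
    have "simple_graph ?W ?G"
      using complete by (auto simp: simple_graph_def complete_edges_def)
    moreover have "\<exists>C. C \<in> graph_cycles ?G"
    proof -
      let ?C = "(\<lambda>s. {s, f s}) ` limit_set f v"
      have comp: "component ?F ((f ^^ k) v) = ?W" for k
        by (induction k) (simp_all add: step)
      have "s \<in> ?W" if "s \<in> limit_set f v" for s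
        using limit_set_reachable[OF that] comp component_self by metis
      then have "?C \<subseteq> ?G"
        using limit_set_closed[of _ f v] by (auto simp: functional_edges_def)
      then have "?C \<in> graph_cycles ?G"
        using limit_set_cycle[OF f, of v] by (auto simp: graph_cycles_def)
      then show ?thesis ..
    qed
    moreover have "C1 = C2" if C: "C1 \<in> graph_cycles ?G" "C2 \<in> graph_cycles ?G" for C1 C2
    proof -
      \<comment> \<open>\<open>s\<close> and \<open>f s\<close> share their limit set, so it is
        constant on components; hence a component has only one cycle.\<close>
      have lim: "limit_set f x = limit_set f y" if "(x, y) \<in> (adjacency ?F)\<^sup>*" for x y
        using that
      proof (induction rule: rtrancl_induct)
        case (step y z)
        then have "z = f y \<or> y = f z" by (simp add: adjacency_def edge_in_functional_edges)
        then have "limit_set f y = limit_set f z" by (metis limit_set_step)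
        with step show ?case by simp
      qed simp
      have "C = (\<lambda>s. {s, f s}) ` limit_set f v" if "C \<in> graph_cycles ?G" for C
      proof -
        obtain c where c: "traverses_cycle c C" and G: "C \<subseteq> ?G"
          using \<open>C \<in> graph_cycles ?G\<close> by (auto simp: graph_cycles_def)
        then have F: "C \<subseteq> ?F" by blast
        have "c ! (0 mod length c) \<in> ?W"
          using traverses_cycle_nth_mod(1)[OF c, of 0] G by blast
        then have "limit_set f (c ! (0 mod length c)) = limit_set f v"
          using lim[of v] by (simp add: component_def)
        then show ?thesis
          using functional_cycle_limit_set[OF c F traverses_cycle_nth_mod(2)[OF c, of 0]]
            functional_cycle_edges[OF c F] by simp
      qed
      then show ?thesis using C by blast
    qed
    ultimately show ?thesis
      using connected_component[of ?F v] unfolding one_tree_def by blast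
  qed
  with complete show ?thesis
    by (auto simp: spanning_one_forests_def graph_components_UNIV)
qed

text \<open>Orient the cycle of each component, and let every other vertex step towards it. An edge
  left over would close a second cycle in its component.\<close>

lemma one_forest_functional_edges:
  fixes F :: "'n::finite set set"
  assumes F: "F \<in> spanning_one_forests UNIV"
  obtains f where "no_short_cycles f" "functional_edges f = F"
proof -
  have card: "card e = 2" if "e \<in> F" for e
    using F that by (auto simp: spanning_one_forests_def complete_edges_def)
  let ?G = "\<lambda>W. {e \<in> F. e \<subseteq> W}"
  have uniq: "\<exists>!C. C \<in> graph_cycles (?G (component F v))" for v
    using F by (auto simp: spanning_one_forests_def graph_components_UNIV one_tree_def)
  \<comment> \<open>Choosing per component rather than per vertex makes all vertices of a component
    agree on one oriented cycle.\<close>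
  have "\<forall>W. \<exists>c. W \<in> range (component F) \<longrightarrow>
      traverses_cycle c (cycle_edges c) \<and> cycle_edges c \<in> graph_cycles (?G W)"
  proof
    fix W
    show "\<exists>c. W \<in> range (component F) \<longrightarrow>
      traverses_cycle c (cycle_edges c) \<and> cycle_edges c \<in> graph_cycles (?G W)"
    proof (cases "W \<in> range (component F)")
      case True
      then obtain C where C: "C \<in> graph_cycles (?G W)" using uniq by blast
      then obtain c where "traverses_cycle c C" by (auto simp: graph_cycles_def)
      with C show ?thesis by (auto simp: traverses_cycle_def)
    qed blast
  qed
  then obtain cyc where "\<forall>W. W \<in> range (component F) \<longrightarrow>
      traverses_cycle (cyc W) (cycle_edges (cyc W)) \<and> cycle_edges (cyc W) \<in> graph_cycles (?G W)"
    by metis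
  then have cyc: "traverses_cycle (cyc (component F v)) (cycle_edges (cyc (component F v)))"
    "cycle_edges (cyc (component F v)) \<in> graph_cycles (?G (component F v))" for v
    by auto
  define c where "c v = cyc (component F v)" for v
  have c: "traverses_cycle (c v) (cycle_edges (c v))" "cycle_edges (c v) \<in> graph_cycles (?G (component F v))"
    for v using cyc by (simp_all add: c_def)
  have c_cong: "c u = c v" if "component F u = component F v" for u v
    using that by (simp add: c_def)
  have c_sub: "cycle_edges (c v) \<subseteq> ?G (component F v)" for v
    using c(2)[of v] by (simp add: graph_cycles_def)
  have c_comp: "component F x = component F v" if "x \<in> set (c v)" for x v
  proof -
    obtain i where "x = c v ! (i mod length (c v))" using set_conv_nth_mod[OF \<open>x \<in> set (c v)\<close>] by blast
    then have "x \<in> component F v" using traverses_cycle_nth_mod(1)[OF c(1), of v i] c_sub[of v] by blast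
    then show ?thesis by (rule component_member)
  qed
  define S where "S = {s. s \<in> set (c s)}"
  have S: "x \<in> S" if "x \<in> set (c v)" for x v
    using that c_cong[OF c_comp[OF that]] by (simp add: S_def)
  \<comment> \<open>Distance in \<open>F\<close> from \<open>v\<close> to the chosen cycles, whose
    union is \<open>S\<close>; it measures the progress of \<open>f\<close> outside
    \<open>S\<close>.\<close>
  define d where "d v = (LEAST k. \<exists>x\<in>S. (v, x) \<in> adjacency F ^^ k)" for v
  have reach: "\<exists>k. \<exists>x\<in>S. (v, x) \<in> adjacency F ^^ k" for v
  proof -
    let ?x = "c v ! (0 mod length (c v))"
    have x: "?x \<in> set (c v)" by (rule traverses_cycle_nth_mod(2)[OF c(1)])
    then have "(v, ?x) \<in> (adjacency F)\<^sup>*" using c_comp[OF x] by (metis component_eq_iff)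
    then show ?thesis using S[OF x] rtrancl_power by blast
  qed
  have "\<exists>t. {s, t} \<in> F \<and>
      (s \<in> S \<longrightarrow> (\<exists>i. s = c s ! (i mod length (c s)) \<and> t = c s ! (Suc i mod length (c s)))) \<and>
      (s \<notin> S \<longrightarrow> d t < d s)" for s
  proof (cases "s \<in> S")
    case True
    then obtain i where "s = c s ! (i mod length (c s))"
      unfolding S_def using set_conv_nth_mod[of s "c s"] by blast
    then show ?thesis
      using True traverses_cycle_nth_mod(1)[OF c(1), of s i] c_sub[of s] by auto
  next
    case False
    obtain x where x: "x \<in> S" "(s, x) \<in> adjacency F ^^ d s"
      using LeastI_ex[OF reach[of s]] unfolding d_def by blast
    have "d s \<noteq> 0" using x False by (metis relpow_0_E)
    then obtain k where k: "d s = Suc k" using not0_implies_Suc by blast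
    obtain t where t: "(s, t) \<in> adjacency F" "(t, x) \<in> adjacency F ^^ k"
      using x(2) unfolding k by (meson relpow_Suc_D2)
    then have "d t \<le> k" unfolding d_def by (intro Least_le) (use x(1) in blast)
    with t(1) k False show ?thesis by (auto simp: adjacency_def)
  qed
  then obtain f where f: "\<And>s. {s, f s} \<in> F"
    "\<And>s. s \<in> S \<Longrightarrow> \<exists>i. s = c s ! (i mod length (c s)) \<and> f s = c s ! (Suc i mod length (c s))"
    "\<And>s. s \<notin> S \<Longrightarrow> d (f s) < d s"
    by metis
  \<comment> \<open>The choice of \<open>f\<close> only provides some index of the vertex;
    distinctness makes it agree with \<open>i\<close> modulo the length.\<close>
  have f_cyc: "f (c v ! (i mod length (c v))) = c v ! (Suc i mod length (c v))" for v i
  proof -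
    let ?r = "length (c v)" and ?s = "c v ! (i mod length (c v))"
    have s: "?s \<in> set (c v)" by (rule traverses_cycle_nth_mod(2)[OF c(1)])
    obtain j where j: "?s = c v ! (j mod ?r)" "f ?s = c v ! (Suc j mod ?r)"
      using f(2)[OF S[OF s]] unfolding c_cong[OF c_comp[OF s]] by blast
    have r: "3 \<le> ?r" "distinct (c v)" using c(1)[of v] by (auto simp: traverses_cycle_def)
    then have "i mod ?r < ?r" "j mod ?r < ?r" by (auto intro!: mod_less_divisor)
    then have "i mod ?r = j mod ?r" using j(1) r(2) nth_eq_iff_index_eq by blast
    then have "Suc i mod ?r = Suc j mod ?r" by (metis mod_Suc_eq)
    then show ?thesis using j(2) by simp
  qed
  have f_S: "f s \<in> S" if "s \<in> S" for s
  proof -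
    obtain i where i: "f s = c s ! (Suc i mod length (c s))" using f(2)[OF \<open>s \<in> S\<close>] by blast
    show ?thesis unfolding i by (rule S[OF traverses_cycle_nth_mod(2)[OF c(1)]])
  qed
  have short: "no_short_cycles f"
    unfolding no_short_cycles_def
  proof (intro allI conjI)
    fix s
    show "f s \<noteq> s" using card[OF f(1)[of s]] by auto
    show "f (f s) \<noteq> s"
    proof (cases "s \<in> S")
      case True
      then obtain i where i: "s = c s ! (i mod length (c s))" using f(2) by blast
      have "f s = c s ! (Suc i mod length (c s))" using f_cyc[of s i] i by simp
      then have "f (f s) = c s ! (Suc (Suc i) mod length (c s))" using f_cyc[of s "Suc i"] by simp
      then show ?thesis using i traverses_cycle_nth_mod(4)[OF c(1), of s i] by metis
    next
      case False
      \<comment> \<open>Either \<open>f s\<close> is in \<open>S\<close> and \<open>f\<close> stays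
        there, or \<open>d\<close> drops twice and cannot be back at \<open>d s\<close>.\<close>
      then show ?thesis using f(3)[of s] f(3)[of "f s"] f_S[of "f s"] by (cases "f s \<in> S") auto
    qed
  qed
  let ?H = "functional_edges f"
  have H: "?H \<subseteq> F" using f(1) by (auto simp: functional_edges_def)
  have cH: "cycle_edges (c v) \<subseteq> ?H" for v
  proof
    fix e assume "e \<in> cycle_edges (c v)"
    then obtain i where i: "i < length (c v)" "e = {c v ! i, c v ! (Suc i mod length (c v))}"
      by (auto simp: cycle_edges_def)
    then show "e \<in> ?H" using f_cyc[of v i] by (simp add: edge_in_functional_edges)
  qed
  have stepH: "component ?H (f s) = component ?H s" for s
    by (metis component_edge edge_in_functional_edges)
  have cycH: "component ?H x = component ?H (c v ! (0 mod length (c v)))" if "x \<in> set (c v)" for x v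
  proof -
    obtain i where "x = c v ! (i mod length (c v))" using set_conv_nth_mod[OF \<open>x \<in> set (c v)\<close>] by blast
    moreover have "component ?H (c v ! (i mod length (c v))) = component ?H (c v ! (0 mod length (c v)))"
      by (induction i) (simp_all add: stepH flip: f_cyc)
    ultimately show ?thesis by simp
  qed
  \<comment> \<open>Following \<open>f\<close> lowers \<open>d\<close> until \<open>S\<close> is
    reached, so within \<open>?H\<close> every vertex is joined to the base point of its
    cycle.\<close>
  have toS: "component ?H u = component ?H (c u ! (0 mod length (c u)))" for u
  proof (induction "d u" arbitrary: u rule: less_induct)
    case less
    show ?case
    proof (cases "u \<in> S")
      case True
      then show ?thesis using cycH by (simp add: S_def)
    next
      case False
      have "c (f u) = c u" using c_cong[OF component_edge[OF f(1)]] by simp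
      then show ?thesis using less[OF f(3)[OF False]] stepH by simp
    qed
  qed
  have "F \<subseteq> ?H"
  proof
    fix e assume e: "e \<in> F"
    then obtain u v where uv: "e = {u, v}" "u \<noteq> v" using card[OF e] by (auto simp: card_2_iff)
    show "e \<in> ?H"
    proof (rule ccontr)
      \<comment> \<open>The ends of a missing edge are joined inside \<open>?H\<close>. The path and
        the edge close a cycle of \<open>F\<close> other than the chosen one, which lies in
        \<open>?H\<close>.\<close>
      assume no: "e \<notin> ?H"
      have comp: "component F u = component F v" using e uv by (simp add: component_edge)
      then have "component ?H u = component ?H v" using toS[of u] toS[of v] c_cong[OF comp] by simp
      then have "(u, v) \<in> (adjacency ?H)\<^sup>*" by (simp add: component_eq_iff)
      from path_of_reachable[OF this] obtain p where p: "path_between UNIV ?H u v p" ..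
      then have p': "p \<noteq> []" "p ! 0 = u" "p ! (length p - 1) = v" "distinct p"
        "successively (\<lambda>x y. {x, y} \<in> ?H) p"
        by (auto simp: path_between_def hd_conv_nth last_conv_nth)
      have edge: "{p ! i, p ! Suc i} \<in> ?H" if "Suc i < length p" for i
        using successively_conv_nth[of "\<lambda>x y. {x, y} \<in> ?H" p] p'(5) that by auto
      \<comment> \<open>One vertex would mean \<open>u = v\<close>, and two would put
        \<open>e\<close> itself into \<open>?H\<close>.\<close>
      have "length p \<noteq> 0" "length p \<noteq> 1" "length p \<noteq> 2"
        using p'(1-3) uv no edge[of 0] by auto
      then have len: "3 \<le> length p" by linarith
      have e_in: "e \<in> cycle_edges p"
      proof -
        have "Suc (length p - 1) = length p" "length p - 1 < length p" using len by linarith+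
        then show ?thesis
          unfolding cycle_edges_def using p'(2,3) uv(1) by (auto intro!: exI[of _ "length p - 1"])
      qed
      have "cycle_edges p \<subseteq> F"
      proof
        fix e' assume "e' \<in> cycle_edges p"
        then obtain i where i: "i < length p" "e' = {p ! i, p ! (Suc i mod length p)}"
          by (auto simp: cycle_edges_def)
        show "e' \<in> F"
        proof (cases "Suc i = length p")
          case True
          then have "i = length p - 1" by linarith
          then have "e' = e" using i(2) True p'(2,3) uv(1) by (simp add: insert_commute)
          then show ?thesis using e by simp
        next
          case False
          then have "Suc i < length p" using i(1) by linarith
          then show ?thesis using i(2) edge[of i] H by auto
        qed
      qed
      moreover have "e' \<subseteq> component F u" if "e' \<in> cycle_edges p" for e'
      proof -
        have "x \<in> component F u" if "x \<in> set p" for x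
        proof -
          have "successively (\<lambda>x y. {x, y} \<in> F) p"
            using p'(5) H by (auto elim!: successively_mono)
          then show ?thesis
            using successively_reachable[of F p x] that p'(1,2) by (simp add: component_def hd_conv_nth)
        qed
        moreover have "Suc i mod length p < length p" for i using len by (intro mod_less_divisor) auto
        ultimately show ?thesis using that by (auto simp: cycle_edges_def)
      qed
      ultimately have "cycle_edges p \<in> graph_cycles (?G (component F u))"
        using len p'(4) by (auto simp: graph_cycles_def traverses_cycle_def)
      then have "cycle_edges p = cycle_edges (c u)" using uniq c(2) by blast
      then show False using e_in cH no by blast
    qed
  qed
  then have "?H = F" using H by blast
  with short show thesis using that by blast
qed

lemma spanning_one_forests_UNIV:
  "spanning_one_forests (UNIV :: 'n::finite set) = functional_edges ` Collect no_short_cycles"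
proof (intro equalityI subsetI)
  fix F :: "'n set set" assume "F \<in> spanning_one_forests UNIV"
  then show "F \<in> functional_edges ` Collect no_short_cycles"
    by (rule one_forest_functional_edges) blast
qed (use functional_edges_one_forest in blast)

text \<open>Grouping the expansion by edge set collects all functions that yield a given forest;
  their determinants add up to the squared modulus for any one of them, which factors over the
  cycles.\<close>

theorem det_gain_laplacian:
  fixes g :: "'n::finite \<Rightarrow> 'n \<Rightarrow> complex"
  assumes g: "\<And>s t. s \<noteq> t \<Longrightarrow> cmod (g s t) = 1" "\<And>s t. s \<noteq> t \<Longrightarrow> g t s = cnj (g s t)"
    and orient: "\<And>C. C \<in> graph_cycles (complete_edges UNIV) \<Longrightarrow> traverses_cycle (orient C) C"
  shows "det (gain_laplacian g w) =
    (\<Sum>F\<in>spanning_one_forests UNIV. (\<Prod>e\<in>F. w e) *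
      of_real (\<Prod>C\<in>graph_cycles F. 2 * (1 - Re (cycle_gain g (orient C)))))"
proof -
  let ?d = "\<lambda>f. det (incidence (\<lambda>s. g s (f s)) f)"
  have inv: "g s t * g t s = 1" if "s \<noteq> t" for s t
    using g[OF that] complex_norm_square[of "g s t"] by simp
  have "det (gain_laplacian g w) =
      (\<Sum>f | no_short_cycles f. (\<Prod>e\<in>functional_edges f. w e) * ?d f)"
    using det_gain_laplacian_functions[of g, OF inv] by simp
  also have "\<dots> = (\<Sum>F\<in>functional_edges ` Collect no_short_cycles.
      \<Sum>f | f \<in> Collect no_short_cycles \<and> functional_edges f = F. (\<Prod>e\<in>functional_edges f. w e) * ?d f)"
    by (rule sum.image_gen) simp
  also have "\<dots> = (\<Sum>F\<in>functional_edges ` Collect no_short_cycles. (\<Prod>e\<in>F. w e) *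
      of_real (\<Prod>C\<in>graph_cycles F. 2 * (1 - Re (cycle_gain g (orient C)))))"
  proof (rule sum.cong[OF refl])
    fix F :: "'n set set" assume "F \<in> functional_edges ` Collect no_short_cycles"
    then obtain h where h: "no_short_cycles h" "F = functional_edges h" by auto
    have "functional_edges h \<subseteq> complete_edges UNIV"
      using functional_edges_one_forest[OF h(1)] by (simp add: spanning_one_forests_def)
    then have or: "traverses_cycle (orient C) C" if "C \<in> graph_cycles (functional_edges h)" for C
      using orient that by (auto simp: graph_cycles_def)
    have cycles: "(cmod (?d h))\<^sup>2 =
        (\<Prod>C\<in>graph_cycles (functional_edges h). 2 * (1 - Re (cycle_gain g (orient C))))"
      by (rule cmod_det_incidence_cycles[OF _ _ h(1)]) (erule g or)+
    have "(\<Sum>f | f \<in> Collect no_short_cycles \<and> functional_edges f = F. (\<Prod>e\<in>functional_edges f. w e) * ?d f) =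
        (\<Prod>e\<in>F. w e) * (\<Sum>f | no_short_cycles f \<and> functional_edges f = F. ?d f)"
      unfolding sum_distrib_left by (intro sum.cong) auto
    also have "(\<Sum>f | no_short_cycles f \<and> functional_edges f = F. ?d f) =
        of_real (\<Prod>C\<in>graph_cycles F. 2 * (1 - Re (cycle_gain g (orient C))))"
      unfolding h(2) cycles[symmetric]
      by (rule sum_det_incidence_same_edges[OF _ _ h(1)]) (erule g)+
    finally show "(\<Sum>f | f \<in> Collect no_short_cycles \<and> functional_edges f = F. (\<Prod>e\<in>functional_edges f. w e) * ?d f) =
        (\<Prod>e\<in>F. w e) * of_real (\<Prod>C\<in>graph_cycles F. 2 * (1 - Re (cycle_gain g (orient C))))" .
  qed
  finally show ?thesis by (simp only: spanning_one_forests_UNIV)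
qed

section \<open>Gains of shortest paths\<close>

lemma lex_le_total: "lex_le z w \<or> lex_le w z"
  by (auto simp: lex_le_def)

lemma lex_le_trans: "lex_le x y \<Longrightarrow> lex_le y z \<Longrightarrow> lex_le x z"
  by (auto simp: lex_le_def)

lemma lex_Max_in:
  assumes "finite S" "S \<noteq> {}"
  shows "lex_Max S \<in> S"
proof -
  have "\<exists>z\<in>S. \<forall>w\<in>S. lex_le w z"
    using assms
  proof (induction rule: finite_ne_induct)
    case (insert x S)
    then obtain z where "z \<in> S" "\<forall>w\<in>S. lex_le w z" by blast
    then show ?case using lex_le_total[of x z] lex_le_total[of x x] lex_le_trans[of _ z x] by blast
  qed (auto simp: lex_le_def)
  then show ?thesis by (metis lex_Max_eq)
qed

lemma lex_Min_in:
  assumes "finite S" "S \<noteq> {}"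
  shows "lex_Min S \<in> S"
proof -
  have "\<exists>z\<in>S. \<forall>w\<in>S. lex_le z w"
    using assms
  proof (induction rule: finite_ne_induct)
    case (insert x S)
    then obtain z where "z \<in> S" "\<forall>w\<in>S. lex_le z w" by blast
    then show ?case using lex_le_total[of x z] lex_le_total[of x x] lex_le_trans[of x z] by blast
  qed (auto simp: lex_le_def)
  then show ?thesis by (metis lex_Min_eq)
qed

lemma finite_shortest_gains:
  fixes E :: "'n::finite set set"
  shows "finite (shortest_gains UNIV E \<phi> u v)"
proof -
  have "shortest_gains UNIV E \<phi> u v \<subseteq> path_gain \<phi> ` {p. distinct p}"
    by (auto simp: shortest_gains_def shortest_path_def path_between_def)
  moreover have "finite {p :: 'n list. distinct p}"
    using finite_subset_distinct[of "UNIV :: 'n set"] by simp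
  ultimately show ?thesis by (meson finite_imageI finite_subset)
qed

lemma shortest_gains_nonempty:
  assumes "connected_graph UNIV E"
  shows "shortest_gains UNIV E \<phi> u v \<noteq> {}"
proof -
  have "\<exists>k p. path_between UNIV E u v p \<and> length p - 1 = k"
    using assms by (simp add: connected_graph_def)
  then have "\<exists>p. path_between UNIV E u v p \<and> length p - 1 = graph_dist UNIV E u v"
    unfolding graph_dist_def by (rule LeastI_ex)
  then show ?thesis by (auto simp: shortest_gains_def shortest_path_def)
qed

lemma cmod_shortest_gains:
  assumes "gain_graph UNIV E \<phi>" "z \<in> shortest_gains UNIV E \<phi> u v"
  shows "cmod z = 1"
proof -
  obtain p where z: "z = path_gain \<phi> p" and p: "successively (\<lambda>x y. {x, y} \<in> E) p"
    using assms(2) by (auto simp: shortest_gains_def shortest_path_def path_between_def)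
  have "cmod (\<phi> (p ! i) (p ! Suc i)) = 1" if "i < length p - 1" for i
  proof -
    have "Suc i < length p" using that by linarith
    then have "{p ! i, p ! Suc i} \<in> E"
      using p successively_conv_nth[of "\<lambda>x y. {x, y} \<in> E" p] by auto
    then show ?thesis using assms(1) by (simp add: gain_graph_def)
  qed
  then show ?thesis by (simp add: z path_gain_def prod_norm[symmetric])
qed

text \<open>The diagonal matters because the common gain compares the two auxiliary gains as
  functions, at all pairs.\<close>

lemma shortest_gains_refl:
  assumes "connected_graph UNIV E"
  shows "shortest_gains UNIV E \<phi> v v = {1}"
proof -
  have "p = [v]" if "path_between UNIV E v v p" for p
    using that by (cases p) (auto simp: path_between_def split: if_splits)
  then have "shortest_gains UNIV E \<phi> v v \<subseteq> {1}"
    by (fastforce simp: shortest_gains_def shortest_path_def path_gain_def)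
  then show ?thesis using shortest_gains_nonempty[OF assms] by (metis subset_singletonD)
qed

lemma graph_dist_refl: "graph_dist UNIV E v v = 0"
proof -
  have "\<exists>p. path_between UNIV E v v p \<and> length p - 1 = 0"
    by (rule exI[of _ "[v]"]) (simp add: path_between_def)
  then show ?thesis unfolding graph_dist_def by (rule Least_eq_0)
qed

text \<open>Allows the distance to be cancelled when entries of the two distance matrices
  agree.\<close>

lemma graph_dist_pos:
  assumes "connected_graph UNIV E" "u \<noteq> v"
  shows "graph_dist UNIV E u v \<noteq> 0"
proof -
  obtain p where "path_between UNIV E u v p" "length p - 1 = graph_dist UNIV E u v"
    using shortest_gains_nonempty[OF assms(1)] by (fastforce simp: shortest_gains_def shortest_path_def)
  moreover from this have "p \<noteq> []" "hd p \<noteq> last p" using assms(2) by (auto simp: path_between_def)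
  then have "1 < length p" by (cases p; cases "tl p") auto
  ultimately show ?thesis by linarith
qed

lemma distance_laplacian_eq_gain_laplacian:
  "Tr_matrix E - (\<chi> s t. if s = t then 0 else g s t * of_nat (graph_dist UNIV E s t)) =
    gain_laplacian g (\<lambda>e. of_nat (pair_dist UNIV E e))"
proof -
  have "(\<Sum>u\<in>UNIV. graph_dist UNIV E s u) = (\<Sum>u\<in>-{s}. graph_dist UNIV E s u)" for s
    by (rule sum.mono_neutral_right) (auto simp: graph_dist_refl)
  then show ?thesis
    by (simp add: vec_eq_iff Tr_matrix_def gain_laplacian_def pair_dist_insert)
qed

lemma det_distance_laplacian:
  fixes E :: "'n::finite set set"
  assumes g: "\<And>s t. s \<noteq> t \<Longrightarrow> cmod (g s t) = 1" "\<And>s t. s \<noteq> t \<Longrightarrow> g t s = cnj (g s t)"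
    and orient: "\<And>C. C \<in> graph_cycles (complete_edges UNIV) \<Longrightarrow> traverses_cycle (orient C) C"
  shows "det (Tr_matrix E - (\<chi> s t. if s = t then 0 else g s t * of_nat (graph_dist UNIV E s t))) =
    complex_of_real (\<Sum>F\<in>spanning_one_forests UNIV. (\<Prod>e\<in>F. real (pair_dist UNIV E e)) *
      (\<Prod>C\<in>graph_cycles F. 2 * (1 - Re (cycle_gain g (orient C)))))"
proof -
  have "det (gain_laplacian g (\<lambda>e. of_nat (pair_dist UNIV E e))) =
    (\<Sum>F\<in>spanning_one_forests UNIV. (\<Prod>e\<in>F. of_nat (pair_dist UNIV E e)) *
      of_real (\<Prod>C\<in>graph_cycles F. 2 * (1 - Re (cycle_gain g (orient C)))))"
    by (rule det_gain_laplacian) (erule g orient)+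
  then show ?thesis by (simp add: distance_laplacian_eq_gain_laplacian)
qed

section \<open>Auxiliary gains and the determinant formulas\<close>

lemma strict_linear_order_asym:
  assumes "strict_linear_order r" "s \<noteq> t"
  shows "(s, t) \<in> r \<longleftrightarrow> (t, s) \<notin> r"
  using assms unfolding strict_linear_order_on_def total_on_def irrefl_def trans_def by blast

lemma gain_max_unit:
  fixes E :: "'n::finite set set"
  assumes "gain_graph UNIV E \<phi>" "connected_graph UNIV E"
  shows "cmod (gain_max r UNIV E \<phi> s t) = 1"
  using cmod_shortest_gains[OF assms(1) lex_Max_in[OF finite_shortest_gains shortest_gains_nonempty[OF assms(2)]]]
  by (simp add: gain_max_def)

lemma gain_min_unit:
  fixes E :: "'n::finite set set"
  assumes "gain_graph UNIV E \<phi>" "connected_graph UNIV E"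
  shows "cmod (gain_min r UNIV E \<phi> s t) = 1"
  using cmod_shortest_gains[OF assms(1) lex_Min_in[OF finite_shortest_gains shortest_gains_nonempty[OF assms(2)]]]
  by (simp add: gain_min_def)

text \<open>Both auxiliary gains have unit modulus and are conjugate-symmetric off the diagonal,
  which is all that the general formula asks of a gain. \<open>orient\<close> may pick any direction
  and starting vertex for each cycle.\<close>

theorem theorem8:
  fixes E :: "'n::finite set set"
    and \<phi> :: "'n \<Rightarrow> 'n \<Rightarrow> complex"
    and r :: "('n \<times> 'n) set"
    and orient :: "'n set set \<Rightarrow> 'n list"
  assumes "gain_graph UNIV E \<phi>"
    and "connected_graph UNIV E"
    and "strict_linear_order r"
    and "\<And>C. C \<in> graph_cycles (complete_edges UNIV) \<Longrightarrow> traverses_cycle (orient C) C"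
  shows "det (DL_max r E \<phi>) = complex_of_real
           (\<Sum>\<Upsilon>\<in>spanning_one_forests UNIV.
              (\<Prod>e\<in>\<Upsilon>. real (pair_dist UNIV E e)) *
              (\<Prod>C\<in>graph_cycles \<Upsilon>. 2 * (1 - Re (cycle_gain (gain_max r UNIV E \<phi>) (orient C))))) \<and>
         det (DL_min r E \<phi>) = complex_of_real
           (\<Sum>\<Upsilon>\<in>spanning_one_forests UNIV.
              (\<Prod>e\<in>\<Upsilon>. real (pair_dist UNIV E e)) *
              (\<Prod>C\<in>graph_cycles \<Upsilon>. 2 * (1 - Re (cycle_gain (gain_min r UNIV E \<phi>) (orient C))))) \<and>
         (D_max r E \<phi> = D_min r E \<phi> \<longrightarrow> det (DL_common r E \<phi>) = complex_of_real
           (\<Sum>\<Upsilon>\<in>spanning_one_forests UNIV.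
              (\<Prod>e\<in>\<Upsilon>. real (pair_dist UNIV E e)) *
              (\<Prod>C\<in>graph_cycles \<Upsilon>. 2 * (1 - Re (cycle_gain (gain_common r UNIV E \<phi>) (orient C))))))"
    (is "?max \<and> ?min \<and> ?common")
proof (intro conjI impI)
  let ?g = "gain_max r UNIV E \<phi>" and ?h = "gain_min r UNIV E \<phi>"
  have g_cnj: "?g t s = cnj (?g s t)" "?h t s = cnj (?h s t)" if "s \<noteq> t" for s t
    using strict_linear_order_asym[OF assms(3) that] by (auto simp: gain_max_def gain_min_def)
  show max: ?max
    unfolding DL_max_def D_max_def
    by (rule det_distance_laplacian) (rule gain_max_unit[OF assms(1,2)] | erule g_cnj assms(4))+
  show ?min
    unfolding DL_min_def D_min_def
    by (rule det_distance_laplacian) (rule gain_min_unit[OF assms(1,2)] | erule g_cnj assms(4))+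
  assume D: "D_max r E \<phi> = D_min r E \<phi>"
  \<comment> \<open>Equal matrices give equal gains: off the diagonal the nonzero distance cancels,
    and on it both gains are 1.\<close>
  have "?g s t = ?h s t" for s t
  proof (cases "s = t")
    case True
    have "lex_Max {1} = 1" "lex_Min {1} = 1"
      using lex_Max_in[of "{1}"] lex_Min_in[of "{1}"] by auto
    then show ?thesis
      unfolding True gain_max_def gain_min_def shortest_gains_refl[OF assms(2)] by simp
  next
    case False
    from D have "D_max r E \<phi> $ s $ t = D_min r E \<phi> $ s $ t" by simp
    then show ?thesis using False graph_dist_pos[OF assms(2) False] by (simp add: D_max_def D_min_def)
  qed
  then have "gain_common r UNIV E \<phi> = ?g"
    unfolding gain_common_def by (intro common_value_same ext)
  moreover have "DL_common r E \<phi> = DL_max r E \<phi>"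
    unfolding DL_common_def by (rule common_value_same) (simp add: DL_max_def DL_min_def D)
  ultimately show "det (DL_common r E \<phi>) = complex_of_real
           (\<Sum>\<Upsilon>\<in>spanning_one_forests UNIV.
              (\<Prod>e\<in>\<Upsilon>. real (pair_dist UNIV E e)) *
              (\<Prod>C\<in>graph_cycles \<Upsilon>. 2 * (1 - Re (cycle_gain (gain_common r UNIV E \<phi>) (orient C)))))"
    using max by simp
qed

end
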